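(* For every integer $d\ge 3$ there exist a sequence of eigenvalues $(\lambda_k)$ of the Laplacian on the flat square torus $\mathbb T^d$, nontrivial functions $\phi_{\lambda_k}$ on $\mathbb T^d$ satisfying $\Delta\phi_{\lambda_k}=\lambda_k\phi_{\lambda_k}$, and for each $k$ a nodal domain $\Omega_{\lambda_k}$ of $\phi_{\lambda_k}$, such that $$\mathrm{Inrad}(\Omega_{\lambda_k})=o\!\left(\lambda_k^{-1/2}\right),$$ i.e. $\lambda_k^{1/2}\,\mathrm{Inrad}(\Omega_{\lambda_k})\to 0$ along the sequence.
   Context: $\mathbb T^d=\mathbb R^d/(2\pi\mathbb Z)^d$ with the flat metric, identified with $[-\pi,\pi]^d$ with opposite faces glued. $\Delta=-\mathrm{div}\nabla$ is the non-negative Laplacian. A nodal domain of $\phi$ is a connected component of $\{\phi\ne 0\}$. $\mathrm{Inrad}(\Omega)$ (inner radius) is the radius of the largest geodesic ball that can be inscribed in $\Omega$ (the supremum of radii of geodesic balls contained in $\Omega$). *)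

theory Defs
  imports "HOL-Analysis.Analysis" "HOL-Library.Landau_Symbols"
begin

section \<open>The flat torus\<close>

text \<open>The dimension is the cardinality of the index type \<open>'n\<close>.\<close>

definition torus_rel :: "real ^ 'n \<Rightarrow> real ^ 'n \<Rightarrow> bool" where
  "torus_rel x y \<longleftrightarrow> (\<forall>i. \<exists>m::int. x $ i - y $ i = 2 * pi * of_int m)"

lemma equivp_torus_rel: "equivp torus_rel"
proof (rule equivpI)
  show "reflp torus_rel"
    by (auto simp: reflp_def torus_rel_def intro: exI[of _ 0])
  show "symp torus_rel"
    unfolding symp_def torus_rel_def
  proof (intro allI impI)
    fix x y :: "real^'n" and i
    assume "\<forall>i. \<exists>m::int. x $ i - y $ i = 2 * pi * of_int m"
    then obtain m :: int where "x $ i - y $ i = 2 * pi * of_int m" by blast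
    then have "y $ i - x $ i = 2 * pi * of_int (- m)" by simp
    then show "\<exists>m::int. y $ i - x $ i = 2 * pi * of_int m" ..
  qed
  show "transp torus_rel"
    unfolding transp_def torus_rel_def
  proof (intro allI impI)
    fix x y z :: "real^'n" and i
    assume "\<forall>i. \<exists>m::int. x $ i - y $ i = 2 * pi * of_int m"
      and "\<forall>i. \<exists>m::int. y $ i - z $ i = 2 * pi * of_int m"
    then obtain m n :: int where "x $ i - y $ i = 2 * pi * of_int m"
      and "y $ i - z $ i = 2 * pi * of_int n" by meson
    then have "x $ i - z $ i = 2 * pi * of_int (m + n)" by (simp add: algebra_simps)
    then show "\<exists>m::int. x $ i - z $ i = 2 * pi * of_int m" ..
  qed
qed

quotient_type 'n torus = "real ^ ('n::finite)" / torus_rel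
  morphisms torus_rep torus_proj
  by (rule equivp_torus_rel)

lemma torus_proj_eq_iff: "torus_proj x = torus_proj y \<longleftrightarrow> torus_rel x y"
  by (rule torus.abs_eq_iff)

lemma torus_proj_surj: "\<exists>x. torus_proj x = p"
  by (metis Quotient3_abs_rep Quotient3_torus)

lemma torus_rel_translate:
  "torus_rel x x' \<Longrightarrow> torus_rel (y + (x' - x)) y"
  using equivp_symp[OF equivp_torus_rel, of x x'] by (simp add: torus_rel_def)

text \<open>The flat (geodesic) distance: the shortest distance between lifts of the two points.\<close>

instantiation torus :: (finite) metric_space
begin

definition dist_torus :: "'a torus \<Rightarrow> 'a torus \<Rightarrow> real" where
  "dist_torus p q = Inf {dist x y | x y. torus_proj x = p \<and> torus_proj y = q}"

definition uniformity_torus :: "('a torus \<times> 'a torus) filter" where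
  "uniformity_torus = (INF e\<in>{0<..}. principal {(p, q). dist p q < e})"

definition open_torus :: "'a torus set \<Rightarrow> bool" where
  "open_torus U \<longleftrightarrow> (\<forall>p\<in>U. eventually (\<lambda>(p', q). p' = p \<longrightarrow> q \<in> U) uniformity)"

lemma dist_torus_le:
  fixes x y :: "real ^ 'a"
  shows "dist (torus_proj x) (torus_proj y) \<le> dist x y"
  unfolding dist_torus_def
  by (rule cInf_lower) (auto intro!: bdd_belowI[of _ 0])

lemma dist_torus_lift:
  fixes x :: "real ^ 'a"
  assumes "dist (torus_proj x) q < r"
  obtains y where "torus_proj y = q" "dist x y < r"
proof -
  let ?S = "{dist x' y | x' y. torus_proj x' = torus_proj x \<and> torus_proj y = q}"
  have "?S \<noteq> {}" using torus_proj_surj by blast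
  then obtain s where "s \<in> ?S" "s < r"
    using assms cInf_lessD[of ?S r] unfolding dist_torus_def by blast
  then obtain x' y where xy: "torus_proj x' = torus_proj x" "torus_proj y = q" "dist x' y < r"
    by blast
  have "torus_proj (y + (x - x')) = q"
    using torus_rel_translate[of x' x y] xy by (metis torus_proj_eq_iff)
  moreover have "dist x (y + (x - x')) = dist x' y"
    by (simp add: dist_norm algebra_simps)
  ultimately show thesis using that xy by metis
qed

lemma torus_rel_close:
  fixes x y :: "real ^ 'a"
  assumes "torus_rel x y" "dist x y < 2 * pi"
  shows "x = y"
proof (rule vec_eq_iff[THEN iffD2], rule allI)
  fix i
  obtain m :: int where m: "x $ i - y $ i = 2 * pi * of_int m"
    using assms(1) unfolding torus_rel_def by blast
  have "\<bar>x $ i - y $ i\<bar> \<le> norm (x - y)"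
    using component_le_norm_cart[of "x - y" i] by simp
  then have "2 * pi * \<bar>of_int m\<bar> < 2 * pi * 1"
    using assms(2) unfolding m dist_norm abs_mult by (simp only: abs_numeral abs_of_pos[OF pi_gt_zero])
  then have "\<bar>of_int m :: real\<bar> < 1"
    by (rule mult_left_less_imp_less) simp
  then have "m = 0" by linarith
  then show "x $ i = y $ i" using m by simp
qed

instance
proof
  show "uniformity = (INF e\<in>{0<..}. principal {(p, q). dist p (q :: 'a torus) < e})"
    by (rule uniformity_torus_def)
  show "open U \<longleftrightarrow> (\<forall>p\<in>U. \<forall>\<^sub>F (p', q) in uniformity. p' = p \<longrightarrow> q \<in> U)" for U :: "'a torus set"
    by (rule open_torus_def)
  have nonneg: "0 \<le> dist p q" for p q :: "'a torus"
  proof -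
    have "{dist x y | x y. torus_proj x = p \<and> torus_proj y = q} \<noteq> {}"
      using torus_proj_surj[of p] torus_proj_surj[of q] by blast
    then show ?thesis
      unfolding dist_torus_def by (rule cInf_greatest) auto
  qed
  have comm: "dist p q = dist q p" for p q :: "'a torus"
  proof -
    have "{dist x y | x y. torus_proj x = p \<and> torus_proj y = q}
        = {dist y x | x y. torus_proj x = p \<and> torus_proj y = q}"
      by (simp add: dist_commute)
    also have "\<dots> = {dist x y | x y. torus_proj x = q \<and> torus_proj y = p}" by blast
    finally show ?thesis by (simp add: dist_torus_def)
  qed
  show "dist p q = 0 \<longleftrightarrow> p = q" for p q :: "'a torus"
  proof
    assume "p = q"
    moreover obtain x where "torus_proj x = p" using torus_proj_surj by blast
    ultimately have "dist p q \<le> 0" using dist_torus_le[of x x] by simp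
    then show "dist p q = 0" using nonneg[of p q] by simp
  next
    assume 0: "dist p q = 0"
    obtain x where x: "torus_proj x = p" using torus_proj_surj by blast
    obtain y where y: "torus_proj y = q" "dist x y < pi"
      using dist_torus_lift[of x q pi] 0 x pi_gt_zero by metis
    have "dist x y \<le> 0 + e" if e: "e > 0" for e :: real
    proof -
      obtain z where z: "torus_proj z = q" "dist x z < min e pi"
        using dist_torus_lift[of x q "min e pi"] 0 x e pi_gt_zero by auto
      have "dist y z < 2 * pi"
        using dist_triangle[of y z x] y z by (simp add: dist_commute)
      then have "y = z"
        using torus_rel_close[of y z] y z torus_proj_eq_iff by metis
      then show ?thesis using z by simp
    qed
    then have "dist x y \<le> 0" by (rule field_le_epsilon)
    then show "p = q" using x y by simp
  qed
  show "dist p q \<le> dist p r + dist q r" for p q r :: "'a torus"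
  proof (rule field_le_epsilon)
    fix e :: real assume e: "e > 0"
    obtain z where z: "torus_proj z = r" using torus_proj_surj by blast
    obtain x where x: "torus_proj x = p" "dist z x < dist p r + e / 2"
      using dist_torus_lift[of z p "dist p r + e / 2"] e z comm[of r p] by auto
    obtain y where y: "torus_proj y = q" "dist z y < dist q r + e / 2"
      using dist_torus_lift[of z q "dist q r + e / 2"] e z comm[of r q] by auto
    have "dist p q \<le> dist x y" using dist_torus_le[of x y] x y by simp
    also have "\<dots> \<le> dist z x + dist z y"
      using dist_triangle[of x y z] by (simp add: dist_commute)
    finally show "dist p q \<le> dist p r + dist q r + e" using x y by simp
  qed
qed

end

text \<open>Geodesic balls of the torus are the images of Euclidean balls.\<close>

lemma torus_proj_ball: "torus_proj ` ball x r = ball (torus_proj x) r"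
proof
  show "torus_proj ` ball x r \<subseteq> ball (torus_proj x) r"
    by (auto intro: le_less_trans[OF dist_torus_le])
  show "ball (torus_proj x) r \<subseteq> torus_proj ` ball x r"
  proof
    fix q assume "q \<in> ball (torus_proj x) r"
    then have "dist (torus_proj x) q < r" by simp
    then obtain y where "torus_proj y = q" "dist x y < r" by (rule dist_torus_lift)
    then show "q \<in> torus_proj ` ball x r" by force
  qed
qed

section \<open>Laplace eigenfunctions\<close>

definition partial_deriv :: "'n::finite \<Rightarrow> (real ^ 'n \<Rightarrow> real) \<Rightarrow> real ^ 'n \<Rightarrow> real" where
  "partial_deriv i f x = deriv (\<lambda>t. f (x + t *\<^sub>R axis i 1)) 0"

primrec Ck :: "nat \<Rightarrow> (real ^ 'n::finite \<Rightarrow> real) \<Rightarrow> bool" where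
  "Ck 0 f \<longleftrightarrow> continuous_on UNIV f"
| "Ck (Suc k) f \<longleftrightarrow> f differentiable_on UNIV \<and> (\<forall>i. Ck k (partial_deriv i f))"

definition torus_smooth :: "('n::finite torus \<Rightarrow> real) \<Rightarrow> bool" where
  "torus_smooth \<phi> \<longleftrightarrow> (\<forall>k. Ck k (\<phi> \<circ> torus_proj))"

text \<open>The sign makes the Laplacian non-negative. The value does not depend on the choice of
  the representative, see \<open>torus_laplacian_proj\<close> below.\<close>

definition torus_laplacian :: "('n::finite torus \<Rightarrow> real) \<Rightarrow> 'n torus \<Rightarrow> real" where
  "torus_laplacian \<phi> p =
    - (\<Sum>i\<in>UNIV. partial_deriv i (partial_deriv i (\<phi> \<circ> torus_proj)) (torus_rep p))"

lemma partial_deriv_torus_rel: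
  assumes "\<And>x y. torus_rel x y \<Longrightarrow> f x = f y" and "torus_rel x y"
  shows "partial_deriv i f x = partial_deriv i f y"
proof -
  have "torus_rel (x + v) (y + v)" for v
    using assms(2) by (simp add: torus_rel_def)
  then have "(\<lambda>t. f (x + t *\<^sub>R axis i 1)) = (\<lambda>t. f (y + t *\<^sub>R axis i 1))"
    using assms(1) by blast
  then show ?thesis by (simp add: partial_deriv_def)
qed

lemma torus_laplacian_proj:
  "torus_laplacian \<phi> (torus_proj x) =
    - (\<Sum>i\<in>UNIV. partial_deriv i (partial_deriv i (\<phi> \<circ> torus_proj)) x)"
proof -
  have rel: "torus_rel (torus_rep (torus_proj x)) x"
    by (metis Quotient3_abs_rep Quotient3_torus torus_proj_eq_iff)
  have "partial_deriv i (partial_deriv i (\<phi> \<circ> torus_proj)) (torus_rep (torus_proj x))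
      = partial_deriv i (partial_deriv i (\<phi> \<circ> torus_proj)) x" for i
    by (intro partial_deriv_torus_rel rel) (auto simp: torus_proj_eq_iff[symmetric])
  then show ?thesis by (simp add: torus_laplacian_def)
qed

definition torus_eigenfunction :: "real \<Rightarrow> ('n::finite torus \<Rightarrow> real) \<Rightarrow> bool" where
  "torus_eigenfunction ev \<phi> \<longleftrightarrow>
     torus_smooth \<phi> \<and> (\<exists>p. \<phi> p \<noteq> 0) \<and> (\<forall>p. torus_laplacian \<phi> p = ev * \<phi> p)"

section \<open>Nodal domains and inner radius\<close>

definition nodal_domains :: "('n::finite torus \<Rightarrow> real) \<Rightarrow> 'n torus set set" where
  "nodal_domains \<phi> = components {p. \<phi> p \<noteq> 0}"

text \<open>The radii are bounded above, so that the supremum is meaningful, unless \<open>\<Omega>\<close> is the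
  whole torus, which is excluded for nodal domains with a positive eigenvalue.\<close>

definition inrad :: "'n::finite torus set \<Rightarrow> real" where
  "inrad \<Omega> = Sup {r. 0 < r \<and> (\<exists>p. ball p r \<subseteq> \<Omega>)}"

end

theory Submission
  imports Defs "HOL-Complex_Analysis.Complex_Analysis"
begin

text \<open>After the rescaling \<open>x \<mapsto> M x\<close>, a superposition of plane waves on \<open>\<real>\<^sup>3\<close> with rational
  frequencies of length \<open>\<surd>2\<close> becomes an eigenfunction on the torus with eigenvalue \<open>2 M\<^sup>2\<close>, constant
  in the remaining coordinates. It therefore suffices to find, for every \<open>\<epsilon> > 0\<close>, such a
  superposition with a bounded positivity domain containing no ball of radius \<open>\<epsilon>\<close>. Start with
  \<open>cos x cos y + cos y cos z + cos z cos x\<close>, whose positivity domain around the origin is confined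
  to a cube up to touching its neighbours in isolated points, and subtract small multiples of
  solutions of the Helmholtz equation that are large on thin tubes around finitely many vertical
  lines but bounded below away from these. In dimension three such solutions exist because lines
  have zero capacity: spread point sources \<open>exp (\<i> k r) / r\<close> along the line to get a logarithmic
  singularity. The sources are then removed by Runge approximation: plane waves with complex
  frequencies are locally uniform limits of plane waves with rational frequencies, distant point
  sources are limits of those, and a source can be pushed along its line without leaving the
  closure. What happens inside the tubes is irrelevant, since the sign on their walls already
  separates the nodal domain from the interior of the tubes.\<close>

section \<open>Analytic families in uniformly closed subspaces\<close>

text \<open>The common squared frequency 2 comes from \<open>cos x * cos y\<close>, which is built
  from the frequencies \<open>(1, 1, 0)\<close> and \<open>(1, -1, 0)\<close>; every correction has
  to solve the same equation. The obstacle is that a solution concentrated on a tube is not small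
  elsewhere, and its negative values, summed over the many tubes that a small \<epsilon> demands,
  might open new passages for the positivity domain. The way out is that the lower bound of a tube
  solution, and its upper bound at a fixed distance from the axis, do not depend on the tube radius
  \<eta>, while its value on the tube wall grows at least like \<open>ln (1 / \<eta>) / 2\<close>.
  So the factor \<kappa> of the corrections can be fixed from the number and the positions of the
  tubes, and \<eta> is shrunk afterwards. On the torus the conclusion is topological: the positive
  part of a compact region is itself open, hence the nodal domain cannot leave the region. As the
  eigenvalue is \<open>2 * M^2\<close> and the inner radius is at most
  \<open>\<epsilon> / M\<close>, their scale-invariant product is at most
  \<open>sqrt 2 * \<epsilon>\<close>.\<close>

lemma higher_deriv_bound:
  assumes "f holomorphic_on ball c r" "\<And>t. t \<in> ball c r \<Longrightarrow> norm (f t) \<le> B"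
    and "0 < r" "t \<in> ball c (r / 2)"
  shows "norm ((deriv ^^ n) f t) \<le> fact n * B / (r / 2) ^ n"
proof (rule Cauchy_inequality)
  have sub: "cball t (r / 2) \<subseteq> ball c r"
  proof
    fix s assume "s \<in> cball t (r / 2)"
    then show "s \<in> ball c r" using assms(4) dist_triangle[of c s t] by simp
  qed
  then show "f holomorphic_on ball t (r / 2)"
    using assms(1) by (meson ball_subset_cball holomorphic_on_subset subset_trans)
  show "continuous_on (cball t (r / 2)) f"
    using assms(1) sub by (meson holomorphic_on_imp_continuous_on holomorphic_on_subset)
  show "norm (f x) \<le> B" if "norm (t - x) = r / 2" for x
    using that sub assms(2) by (auto simp: dist_norm subset_iff)
qed (use assms in auto)

text \<open>Cauchy's inequality on discs of radius \<open>r / 2\<close> about the points of the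
  half-size ball controls the remainder by \<open>B\<close> and \<open>r\<close> alone, so the
  estimate is uniform over a family with a common bound.\<close>

lemma higher_deriv_Taylor:
  assumes "f holomorphic_on ball c r" "\<And>t. t \<in> ball c r \<Longrightarrow> norm (f t) \<le> B"
    and "0 < r" "s \<in> ball c (r / 2)" "t \<in> ball c (r / 2)"
  shows "norm ((deriv ^^ m) f t - (\<Sum>i\<le>n. (deriv ^^ (m + i)) f s * (t - s) ^ i / fact i))
     \<le> fact (m + Suc n) * B / (r / 2) ^ (m + Suc n) * norm (t - s) ^ Suc n / fact n"
proof -
  have "norm ((\<lambda>i. (deriv ^^ (m + i)) f) 0 t - (\<Sum>i\<le>n. (\<lambda>i. (deriv ^^ (m + i)) f) i s * (t - s) ^ i / fact i))
     \<le> fact (m + Suc n) * B / (r / 2) ^ (m + Suc n) * norm (t - s) ^ Suc n / fact n"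
  proof (rule complex_Taylor[where S = "ball c (r / 2)"])
    show "((deriv ^^ (m + i)) f has_field_derivative (deriv ^^ (m + Suc i)) f x)
        (at x within ball c (r / 2))" if "x \<in> ball c (r / 2)" for x i
    proof -
      have "x \<in> ball c r" using that assms(3) by simp
      then have "((deriv ^^ (m + i)) f has_field_derivative (deriv ^^ Suc (m + i)) f x) (at x)"
        by (intro has_field_derivative_higher_deriv[OF assms(1)]) auto
      then show ?thesis by (simp add: has_field_derivative_at_within)
    qed
    show "norm ((deriv ^^ (m + Suc n)) f x) \<le> fact (m + Suc n) * B / (r / 2) ^ (m + Suc n)"
      if "x \<in> ball c (r / 2)" for x
      using higher_deriv_bound[OF assms(1-3) that] by blast
  qed (use assms in auto)
  then show ?thesis by simp
qed

text \<open>The closure is uniform on \<open>K\<close> only: \<open>lim\<close> makes membership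
  depend on the values on \<open>K\<close>, so functions may be altered freely elsewhere.\<close>

locale uniformly_closed_subspace =
  fixes K :: "'p set" and X :: "('p \<Rightarrow> complex) set"
  assumes add: "f \<in> X \<Longrightarrow> g \<in> X \<Longrightarrow> (\<lambda>p. f p + g p) \<in> X"
    and scale: "f \<in> X \<Longrightarrow> (\<lambda>p. c * f p) \<in> X"
    and lim: "(\<And>e. e > 0 \<Longrightarrow> \<exists>g\<in>X. \<forall>p\<in>K. norm (f p - g p) \<le> e) \<Longrightarrow> f \<in> X"
begin

lemma cong: "f \<in> X \<Longrightarrow> (\<And>p. p \<in> K \<Longrightarrow> g p = f p) \<Longrightarrow> g \<in> X"
  by (rule lim) force

lemma zero_mem:
  assumes "X \<noteq> {}"
  shows "(\<lambda>p. 0) \<in> X"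
proof -
  obtain f where "f \<in> X" using assms by blast
  from scale[OF this, of 0] show ?thesis by simp
qed

lemma sum_mem:
  assumes "X \<noteq> {}" "\<And>i. i \<in> I \<Longrightarrow> f i \<in> X"
  shows "(\<lambda>p. \<Sum>i\<in>I. f i p) \<in> X"
  using assms(2)
proof (induction I rule: infinite_finite_induct)
  case (insert i I)
  then show ?case using add[of "f i" "\<lambda>p. \<Sum>i\<in>I. f i p"] by simp
qed (auto simp: zero_mem assms(1))

text \<open>Difference quotients of the \<open>n\<close>-th parameter derivative are members, and
  the second-order Taylor remainder makes them converge uniformly on \<open>K\<close>. The shift
  \<open>h\<close> is real, as membership is assumed on a real segment, and it varies in the
  induction because a quotient uses two base points.\<close>

lemma deriv_mem:
  assumes hol: "\<And>p. p \<in> K \<Longrightarrow> (\<lambda>t. f t p) holomorphic_on ball c r"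
    and bd: "\<And>p t. p \<in> K \<Longrightarrow> t \<in> ball c r \<Longrightarrow> norm (f t p) \<le> B"
    and r: "0 < r" and d: "0 < d"
    and mem: "\<And>h::real. \<bar>h\<bar> < d \<Longrightarrow> f (c + of_real h) \<in> X"
    and h: "\<bar>h\<bar> < min d (r / 2)"
  shows "(\<lambda>p. (deriv ^^ n) (\<lambda>t. f t p) (c + of_real h)) \<in> X"
  using h
proof (induction n arbitrary: h)
  case 0
  then show ?case using mem by simp
next
  case (Suc n)
  let ?D = "\<lambda>n t p. (deriv ^^ n) (\<lambda>t. f t p) t"
  define C where "C = fact (n + 2) * \<bar>B\<bar> / (r / 2) ^ (n + 2)"
  have C: "C \<ge> 0" using r by (simp add: C_def)
  show ?case
  proof (rule lim)
    fix e :: real assume e: "e > 0"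
    \<comment> \<open>The first bound makes the error \<open>C * \<delta>\<close> at most
      \<open>e\<close>; the second keeps \<open>h + \<delta>\<close> in the range of the induction
      hypothesis.\<close>
    define \<delta> where "\<delta> = min (e / (C + 1)) ((min d (r / 2) - \<bar>h\<bar>) / 2)"
    have dpos: "\<delta> > 0" using e Suc.prems C unfolding \<delta>_def min_less_iff_conj
      by (intro conjI divide_pos_pos) auto
    have h': "\<bar>h + \<delta>\<bar> < min d (r / 2)"
    proof -
      have "\<delta> \<le> (min d (r / 2) - \<bar>h\<bar>) / 2" unfolding \<delta>_def by (rule min.cobounded2)
      moreover have "\<bar>h + \<delta>\<bar> \<le> \<bar>h\<bar> + \<delta>" using dpos by linarith
      moreover have "b < m" if "x \<le> (m - a) / 2" "b \<le> a + x" "a < m" for x m a b :: real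
        using that by argo
      ultimately show ?thesis using Suc.prems by blast
    qed
    define g where "g = (\<lambda>p. of_real (1 / \<delta>) * (?D n (c + of_real (h + \<delta>)) p + (-1) * ?D n (c + of_real h) p))"
    have "g \<in> X" unfolding g_def
      by (intro scale add Suc.IH h' Suc.prems)
    moreover have "norm (?D (Suc n) (c + of_real h) p - g p) \<le> e" if p: "p \<in> K" for p
    proof -
      let ?s = "c + of_real h" and ?t = "c + of_real (h + \<delta>)"
      have "norm (?D n ?t p - (\<Sum>i\<le>1. ?D (n + i) ?s p * (?t - ?s) ^ i / fact i))
        \<le> fact (n + Suc 1) * \<bar>B\<bar> / (r / 2) ^ (n + Suc 1) * norm (?t - ?s) ^ Suc 1 / fact 1"
      proof (rule higher_deriv_Taylor)
        show "(\<lambda>t. f t p) holomorphic_on ball c r" using hol p .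
        show "norm (f t p) \<le> \<bar>B\<bar>" if "t \<in> ball c r" for t using bd[OF p that] by simp
      qed (use r h' Suc.prems in \<open>auto simp: dist_norm simp flip: of_real_add\<close>)
      also have "\<dots> = C * \<delta>\<^sup>2" using dpos by (simp add: C_def power2_eq_square)
      finally have "norm (?D n ?t p - ?D n ?s p - ?D (Suc n) ?s p * of_real \<delta>) \<le> C * \<delta>\<^sup>2"
        by (simp add: algebra_simps)
      then have 1: "norm (?D n ?t p - ?D n ?s p - ?D (Suc n) ?s p * of_real \<delta>) / \<delta> \<le> C * \<delta>"
        using dpos by (simp add: divide_le_eq power2_eq_square mult.assoc)
      have "?D (Suc n) ?s p - g p = - (?D n ?t p - ?D n ?s p - ?D (Suc n) ?s p * of_real \<delta>) / of_real \<delta>"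
        using dpos unfolding g_def by (simp add: field_simps del: funpow.simps)
      then have "norm (?D (Suc n) ?s p - g p) = norm (?D n ?t p - ?D n ?s p - ?D (Suc n) ?s p * of_real \<delta>) / \<delta>"
        using dpos by (simp only: norm_divide norm_minus_cancel norm_of_real abs_of_pos)
      also note 1
      also have "C * \<delta> \<le> C * (e / (C + 1))" unfolding \<delta>_def using C by (intro mult_left_mono) auto
      also have "\<dots> \<le> e"
      proof -
        have "C * e \<le> e * (C + 1)" using e by (simp add: algebra_simps)
        then show ?thesis using C by (simp add: divide_le_eq)
      qed
      finally show ?thesis .
    qed
    ultimately show "\<exists>g\<in>X. \<forall>p\<in>K. norm (?D (Suc n) (c + of_real h) p - g p) \<le> e" by blast
  qed
qed

text \<open>The Taylor polynomials at \<open>c\<close> have members as coefficients by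
  \<open>deriv_mem\<close>, and on the half-size disc they converge uniformly on \<open>K\<close>.
  Membership on a short real segment thus spreads to a disc whose radius is governed by the domain
  of analyticity and not by \<open>d\<close>.\<close>

lemma continuation_mem:
  assumes hol: "\<And>p. p \<in> K \<Longrightarrow> (\<lambda>t. f t p) holomorphic_on ball c r"
    and bd: "\<And>p t. p \<in> K \<Longrightarrow> t \<in> ball c r \<Longrightarrow> norm (f t p) \<le> B"
    and r: "0 < r" and d: "0 < d"
    and mem: "\<And>h::real. \<bar>h\<bar> < d \<Longrightarrow> f (c + of_real h) \<in> X"
    and t: "t \<in> ball c (r / 2)"
  shows "f t \<in> X"
proof (rule lim)
  fix e :: real assume e: "e > 0"
  let ?D = "\<lambda>n t p. (deriv ^^ n) (\<lambda>t. f t p) t"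
  have ne: "X \<noteq> {}" using mem[of 0] d by auto
  define q where "q = norm (t - c) / (r / 2)"
  have q: "0 \<le> q" "q < 1" using t r by (auto simp: q_def dist_norm norm_minus_commute divide_less_eq)
  have "(\<lambda>n. of_nat n * q ^ n) \<longlonglongrightarrow> 0"
    using q by (intro powser_times_n_limit_0) auto
  then have "(\<lambda>n. \<bar>B\<bar> * (of_nat n * q ^ n)) \<longlonglongrightarrow> 0" by (rule tendsto_mult_right_zero)
  then have "(\<lambda>n. \<bar>B\<bar> * (of_nat (Suc n) * q ^ Suc n)) \<longlonglongrightarrow> 0" by (rule LIMSEQ_Suc)
  then have "eventually (\<lambda>n. \<bar>B\<bar> * (of_nat (Suc n) * q ^ Suc n) < e) sequentially"
    using e by (rule order_tendstoD(2))
  then obtain n where n: "\<bar>B\<bar> * (of_nat (Suc n) * q ^ Suc n) < e"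
    by (meson eventually_sequentially order_refl)
  define g where "g = (\<lambda>p. \<Sum>i\<le>n. ((t - c) ^ i / fact i) * ?D i c p)"
  have "g \<in> X" unfolding g_def
  proof (intro sum_mem scale ne)
    fix i
    show "?D i c \<in> X" using deriv_mem[where h = 0, OF hol bd r d mem] r d by simp
  qed
  moreover have "norm (f t p - g p) \<le> e" if p: "p \<in> K" for p
  proof -
    have "norm (?D 0 t p - (\<Sum>i\<le>n. ?D (0 + i) c p * (t - c) ^ i / fact i))
      \<le> fact (0 + Suc n) * \<bar>B\<bar> / (r / 2) ^ (0 + Suc n) * norm (t - c) ^ Suc n / fact n"
    proof (rule higher_deriv_Taylor)
      show "(\<lambda>t. f t p) holomorphic_on ball c r" using hol p .
      show "norm (f t p) \<le> \<bar>B\<bar>" if "t \<in> ball c r" for t using bd[OF p that] by simp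
    qed (use r t in auto)
    also have "\<dots> = \<bar>B\<bar> * (of_nat (Suc n) * q ^ Suc n)"
    proof -
      have "fact (Suc n) * b / c * a / fact n = b * (of_nat (Suc n) * (a / c))" for a b c :: real
        by (simp add: fact_Suc del: of_nat_Suc)
      then show ?thesis unfolding q_def power_divide by simp
    qed
    also have "\<dots> \<le> e" using n by simp
    finally show ?thesis by (simp add: g_def mult.commute)
  qed
  ultimately show "\<exists>g\<in>X. \<forall>p\<in>K. norm (f t p - g p) \<le> e" by blast
qed

text \<open>Equidistant Riemann sums are finite combinations of members, and a modulus of continuity
  in \<open>s\<close> common to all \<open>p\<close> makes their error uniform on
  \<open>K\<close>.\<close>

lemma Riemann_sum_mem:
  fixes f :: "real \<Rightarrow> 'p \<Rightarrow> complex"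
  assumes mem: "\<And>s. s \<in> {0..1} \<Longrightarrow> f s \<in> X"
    and int: "\<And>p. p \<in> K \<Longrightarrow> ((\<lambda>s. f s p) has_integral g p) {0..1}"
    and unif: "\<And>e. e > 0 \<Longrightarrow> \<exists>d>0. \<forall>p\<in>K. \<forall>s\<in>{0..1}. \<forall>t\<in>{0..1}. \<bar>s - t\<bar> < d \<longrightarrow> norm (f s p - f t p) \<le> e"
  shows "g \<in> X"
proof (rule lim)
  fix e :: real assume e: "e > 0"
  obtain d where d: "d > 0"
    and dd: "\<And>p s t. p \<in> K \<Longrightarrow> s \<in> {0..1} \<Longrightarrow> t \<in> {0..1} \<Longrightarrow> \<bar>s - t\<bar> < d \<Longrightarrow> norm (f s p - f t p) \<le> e"
    using unif[OF e] by blast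
  obtain M :: nat where M: "M > 0" "1 / real M < d"
    using reals_Archimedean[OF d] by (metis inverse_eq_divide zero_less_Suc)
  have ne: "X \<noteq> {}" using mem[of 0] by auto
  define G where "G = (\<lambda>p. \<Sum>j<M. of_real (1 / M) * f (real j / M) p)"
  have "G \<in> X" unfolding G_def
    using M by (intro sum_mem scale mem ne) (auto simp: field_simps)
  moreover have "norm (g p - G p) \<le> e" if p: "p \<in> K" for p
  proof -
    have part: "norm (integral {0..real k / M} (\<lambda>s. f s p) - (\<Sum>j<k. of_real (1 / M) * f (real j / M) p)) \<le> k * (e / M)"
      if "k \<le> M" for k
      using that
    proof (induction k)
      case (Suc k)
      let ?a = "real k / M" and ?b = "real (Suc k) / M"
      have ab: "0 \<le> ?a" "?a \<le> ?b" "?b \<le> 1" "?b - ?a = 1 / M"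
        using Suc.prems M by (auto simp: divide_simps)
      have on: "(\<lambda>s. f s p) integrable_on {u..v}" if "0 \<le> u" "v \<le> 1" for u v
        using int[OF p] that by (meson atLeastatMost_subset_iff has_integral_integrable integrable_on_subinterval)
      have split: "integral {0..?b} (\<lambda>s. f s p) = integral {0..?a} (\<lambda>s. f s p) + integral {?a..?b} (\<lambda>s. f s p)"
        using Henstock_Kurzweil_Integration.integral_combine[OF ab(1,2) on] ab by simp
      have "((\<lambda>s. f s p - f ?a p) has_integral (integral {?a..?b} (\<lambda>s. f s p) - (?b - ?a) *\<^sub>R f ?a p)) {?a..?b}"
        using ab on[of ?a ?b] has_integral_const_real[of "f ?a p" ?a ?b]
        by (intro has_integral_diff integrable_integral) auto
      then have "norm (integral {?a..?b} (\<lambda>s. f s p) - (?b - ?a) *\<^sub>R f ?a p) \<le> e * measure lborel {?a..?b}"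
      proof (rule has_integral_bound[rotated, where f = "\<lambda>s. f s p - f ?a p", unfolded box_real])
        fix s assume s: "s \<in> {?a..?b}"
        then have "\<bar>s - ?a\<bar> < d" using ab(4) M(2) by auto
        moreover have "s \<in> {0..1}" "?a \<in> {0..1}"
          using s ab(1-3) unfolding atLeastAtMost_iff by linarith+
        ultimately show "norm (f s p - f ?a p) \<le> e" using dd p by blast
      qed (use e in auto)
      moreover have "e * measure lborel {?a..?b} = e / M"
        using ab by (simp del: of_nat_Suc)
      ultimately have "norm (integral {?a..?b} (\<lambda>s. f s p) - of_real (1 / M) * f ?a p) \<le> e / M"
        unfolding ab(4) by (simp add: scaleR_conv_of_real)
      then have "norm ((integral {0..?a} (\<lambda>s. f s p) - (\<Sum>j<k. of_real (1 / M) * f (real j / M) p))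
         + (integral {?a..?b} (\<lambda>s. f s p) - of_real (1 / M) * f ?a p)) \<le> k * (e / M) + e / M"
        using Suc by (intro norm_triangle_mono) auto
      then show ?case unfolding split by (simp add: algebra_simps add_divide_distrib)
    qed simp
    have "integral {0..1} (\<lambda>s. f s p) = g p" using int[OF p] by (rule integral_unique)
    then show ?thesis using part[of M] M by (simp add: G_def)
  qed
  ultimately show "\<exists>G\<in>X. \<forall>p\<in>K. norm (g p - G p) \<le> e" by blast
qed

end

section \<open>Superpositions of plane waves with rational frequencies\<close>

text \<open>A point \<open>(x, y, z)\<close> of space is encoded as the pair \<open>(x + \<i> y, z)\<close>.\<close>

inductive_set waves :: "(complex \<times> real \<Rightarrow> complex) set" where
  zero: "(\<lambda>p. 0) \<in> waves"
| step: "\<lbrakk>f \<in> waves; a \<in> \<rat>; b \<in> \<rat>; c \<in> \<rat>; a\<^sup>2 + b\<^sup>2 + c\<^sup>2 = 2\<rbrakk>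
    \<Longrightarrow> (\<lambda>p. f p + C * cis (a * Re (fst p) + b * Im (fst p) + c * snd p)) \<in> waves"

lemma waves_cis:
  assumes "a \<in> \<rat>" "b \<in> \<rat>" "c \<in> \<rat>" "a\<^sup>2 + b\<^sup>2 + c\<^sup>2 = 2"
  shows "(\<lambda>p. cis (a * Re (fst p) + b * Im (fst p) + c * snd p)) \<in> waves"
  using waves.step[OF waves.zero assms, of 1] by simp

lemma waves_add:
  assumes "f \<in> waves" "g \<in> waves"
  shows "(\<lambda>p. f p + g p) \<in> waves"
  using assms(2)
proof (induction g rule: waves.induct)
  case (step g a b c C)
  show ?case
    using waves.step[OF step.IH step.hyps(2-5), of C] by (simp only: add.assoc)
qed (simp add: assms(1))

lemma waves_scale: "f \<in> waves \<Longrightarrow> (\<lambda>p. d * f p) \<in> waves"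
proof (induction f rule: waves.induct)
  case (step f a b c C)
  show ?case
    using waves.step[OF step.IH step.hyps(2-5), of "d * C"] by (simp only: distrib_left mult.assoc)
qed (simp add: waves.zero)

lemma waves_sum: "(\<And>i. i \<in> I \<Longrightarrow> f i \<in> waves) \<Longrightarrow> (\<lambda>p. \<Sum>i\<in>I. f i p) \<in> waves"
  by (induction I rule: infinite_finite_induct) (auto intro: waves_add waves.zero)

lemma waves_translate: "f \<in> waves \<Longrightarrow> (\<lambda>p. f (fst p - w, snd p)) \<in> waves"
proof (induction f rule: waves.induct)
  case (step f a b c C)
  have "C * cis (a * Re (fst p - w) + b * Im (fst p - w) + c * snd p)
      = (C * cis (- (a * Re w + b * Im w))) * cis (a * Re (fst p) + b * Im (fst p) + c * snd p)" for p
    by (simp add: cis_mult right_diff_distrib add_diff_eq diff_add_eq)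
  then show ?case
    using waves.step[OF step.IH step.hyps(2-5), of "C * cis (- (a * Re w + b * Im w))"]
    by (simp only: fst_conv snd_conv)
qed (simp add: waves.zero)

definition wclosure :: "(complex \<times> real) set \<Rightarrow> (complex \<times> real \<Rightarrow> complex) set" where
  "wclosure K = {f. \<forall>e>0. \<exists>g\<in>waves. \<forall>p\<in>K. norm (f p - g p) \<le> e}"

interpretation wclosure: uniformly_closed_subspace K "wclosure K" for K
proof
  fix f g :: "complex \<times> real \<Rightarrow> complex" and c
  show "(\<lambda>p. f p + g p) \<in> wclosure K" if fg: "f \<in> wclosure K" "g \<in> wclosure K"
    unfolding wclosure_def
  proof (intro CollectI allI impI)
    fix e :: real assume "e > 0"
    then have e: "e / 2 > 0" by simp
    obtain f' where f': "f' \<in> waves" "\<forall>p\<in>K. norm (f p - f' p) \<le> e / 2"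
      using fg(1) e unfolding wclosure_def by blast
    obtain g' where g': "g' \<in> waves" "\<forall>p\<in>K. norm (g p - g' p) \<le> e / 2"
      using fg(2) e unfolding wclosure_def by blast
    from f' g' have "(\<lambda>p. f' p + g' p) \<in> waves" by (intro waves_add)
    moreover have "norm (f p + g p - (f' p + g' p)) \<le> e" if "p \<in> K" for p
      using norm_triangle_mono[of "f p - f' p" "e / 2" "g p - g' p" "e / 2"] f' g' that
      by (simp add: algebra_simps)
    ultimately show "\<exists>h\<in>waves. \<forall>p\<in>K. norm (f p + g p - h p) \<le> e"
      by (intro bexI[of _ "\<lambda>p. f' p + g' p"]) auto
  qed
  show "(\<lambda>p. c * f p) \<in> wclosure K" if f: "f \<in> wclosure K"
    unfolding wclosure_def
  proof (intro CollectI allI impI)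
    fix e :: real assume e: "e > 0"
    then have "e / (norm c + 1) > 0" by (simp add: add_nonneg_pos)
    then obtain f' where f': "f' \<in> waves" and 1: "\<forall>p\<in>K. norm (f p - f' p) \<le> e / (norm c + 1)"
      using f unfolding wclosure_def by blast
    have "norm (c * f p - c * f' p) \<le> e" if "p \<in> K" for p
    proof -
      have "norm (c * f p - c * f' p) = norm c * norm (f p - f' p)"
        by (simp add: norm_mult flip: right_diff_distrib)
      also have "\<dots> \<le> (norm c + 1) * (e / (norm c + 1))"
        using 1 that by (intro mult_mono) auto
      also have "\<dots> = e"
        using norm_ge_zero[of c] by (simp add: add_nonneg_eq_0_iff)
      finally show ?thesis .
    qed
    then show "\<exists>h\<in>waves. \<forall>p\<in>K. norm (c * f p - h p) \<le> e" 
      by (intro bexI[OF _ waves_scale[OF f', of c]]) auto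
  qed
  show "f \<in> wclosure K" if f: "\<And>e. e > 0 \<Longrightarrow> \<exists>g\<in>wclosure K. \<forall>p\<in>K. norm (f p - g p) \<le> e"
    unfolding wclosure_def
  proof (intro CollectI allI impI)
    fix e :: real assume "e > 0"
    then have e: "e / 2 > 0" by simp
    obtain g where g: "g \<in> wclosure K" "\<forall>p\<in>K. norm (f p - g p) \<le> e / 2" using f[OF e] by blast
    then obtain h where h: "h \<in> waves" "\<forall>p\<in>K. norm (g p - h p) \<le> e / 2"
      using e unfolding wclosure_def by blast
    have "norm (f p - h p) \<le> e" if "p \<in> K" for p
      using norm_triangle_mono[of "f p - g p" "e / 2" "g p - h p" "e / 2"] g h that
      by simp
    then show "\<exists>h\<in>waves. \<forall>p\<in>K. norm (f p - h p) \<le> e" using h by blast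
  qed
qed

section \<open>Rational points on the sphere of squared radius 2\<close>

lemma rational_sequence:
  fixes x :: real
  obtains q where "\<And>n. q n \<in> \<rat>" "q \<longlonglongrightarrow> x"
proof -
  have "\<forall>n. \<exists>r\<in>\<rat>. x < r \<and> r < x + 1 / real (Suc n)"
    by (auto intro!: Rats_dense_in_real)
  then obtain q where q: "\<And>n. q n \<in> \<rat>" "\<And>n. x < q n" "\<And>n. q n < x + 1 / real (Suc n)" by metis
  have "(\<lambda>n. x + 1 / real (Suc n)) \<longlonglongrightarrow> x + 0"
    by (intro tendsto_intros LIMSEQ_Suc[OF lim_1_over_n])
  then have "q \<longlonglongrightarrow> x"
    using q by (intro tendsto_sandwich[of "\<lambda>_. x" q sequentially "\<lambda>n. x + 1 / real (Suc n)"])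
      (auto intro!: always_eventually less_imp_le)
  then show thesis using that q by blast
qed

text \<open>Every point of the sphere is the reflection of \<open>(1, 1, 0)\<close> in the hyperplane orthogonal
  to some \<open>v\<close>, and reflections in rational directions preserve rationality.\<close>

lemma rational_points_on_sphere_dense:
  fixes a b c :: real
  assumes "a\<^sup>2 + b\<^sup>2 + c\<^sup>2 = 2" "e > 0"
  obtains a' b' c' where "a' \<in> \<rat>" "b' \<in> \<rat>" "c' \<in> \<rat>" "a'\<^sup>2 + b'\<^sup>2 + c'\<^sup>2 = 2"
    "\<bar>a - a'\<bar> < e" "\<bar>b - b'\<bar> < e" "\<bar>c - c'\<bar> < e"
proof (cases "a = 1 \<and> b = 1 \<and> c = 0")
  case True
  then show ?thesis using that[of 1 1 0] assms by simp
next
  case False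
  obtain u v w where r: "\<And>n. u n \<in> \<rat>" "\<And>n. v n \<in> \<rat>" "\<And>n. w n \<in> \<rat>"
    and lim: "u \<longlonglongrightarrow> 1 - a" "v \<longlonglongrightarrow> 1 - b" "w \<longlonglongrightarrow> - c"
    by (rule rational_sequence[of "1 - a"], rule rational_sequence[of "1 - b"],
        rule rational_sequence[of "- c"]) blast
  \<comment> \<open>With \<open>e = (1, 1, 0)\<close> and direction
    \<open>v = (u n, v n, w n)\<close> the reflected point is \<open>e - S n * v\<close>, where
    \<open>S n\<close> is twice the inner product of \<open>e\<close> and \<open>v\<close> over the
    square of \<open>v\<close>. In the limit \<open>v = e - (a, b, c)\<close> the factor is 1,
    because both points have squared length 2.\<close>
  define S where "S = (\<lambda>n. 2 * (u n + v n) / ((u n)\<^sup>2 + (v n)\<^sup>2 + (w n)\<^sup>2))"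
  have sq: "(1 - a)\<^sup>2 + (1 - b)\<^sup>2 + (- c)\<^sup>2 = 2 * ((1 - a) + (1 - b))"
    using assms(1) by (simp add: power2_eq_square algebra_simps)
  have ne: "(1 - a)\<^sup>2 + (1 - b)\<^sup>2 + (- c)\<^sup>2 \<noteq> 0"
    using False by (auto simp: add_nonneg_eq_0_iff)
  have "S \<longlonglongrightarrow> 2 * ((1 - a) + (1 - b)) / ((1 - a)\<^sup>2 + (1 - b)\<^sup>2 + (- c)\<^sup>2)"
    unfolding S_def by (intro tendsto_intros lim ne)
  then have S: "S \<longlonglongrightarrow> 1" using ne unfolding sq by simp
  have "(\<lambda>n. 1 - S n * u n) \<longlonglongrightarrow> 1 - 1 * (1 - a)" "(\<lambda>n. 1 - S n * v n) \<longlonglongrightarrow> 1 - 1 * (1 - b)"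
    "(\<lambda>n. - S n * w n) \<longlonglongrightarrow> - 1 * - c"
    by (intro tendsto_intros lim S)+
  then have "eventually (\<lambda>n. dist (1 - S n * u n) a < e) sequentially"
    "eventually (\<lambda>n. dist (1 - S n * v n) b < e) sequentially"
    "eventually (\<lambda>n. dist (- S n * w n) c < e) sequentially"
    using \<open>e > 0\<close> by (auto dest!: tendstoD)
  then have "eventually (\<lambda>n. dist (1 - S n * u n) a < e \<and> dist (1 - S n * v n) b < e
    \<and> dist (- S n * w n) c < e) sequentially"
    by eventually_elim simp
  then obtain n where n: "dist (1 - S n * u n) a < e" "dist (1 - S n * v n) b < e" "dist (- S n * w n) c < e"
    by (auto dest: eventually_happens'[OF sequentially_bot])
  have Sr: "S n \<in> \<rat>" unfolding S_def using r by (intro Rats_divide Rats_mult Rats_add Rats_power) auto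
  have "(1 - S n * u n)\<^sup>2 + (1 - S n * v n)\<^sup>2 + (- S n * w n)\<^sup>2
    = 2 + S n * (S n * ((u n)\<^sup>2 + (v n)\<^sup>2 + (w n)\<^sup>2) - 2 * (u n + v n))"
    by (simp add: power2_eq_square algebra_simps)
  also have "\<dots> = 2" unfolding S_def by simp
  finally have "(1 - S n * u n)\<^sup>2 + (1 - S n * v n)\<^sup>2 + (- S n * w n)\<^sup>2 = 2" .
  then show ?thesis
    using that[of "1 - S n * u n" "1 - S n * v n" "- S n * w n"] n r Sr
    by (auto simp: dist_real_def abs_minus_commute)
qed

text \<open>Large enough for the cube of half-side \<open>pi\<close> after translation by the axis
  of any tube: by \<open>norm_square_diff_le\<close>, horizontal differences have norm at most
  10.\<close>

definition cylinder :: "(complex \<times> real) set" where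
  "cylinder = {p. norm (fst p) \<le> 10 \<and> \<bar>snd p\<bar> \<le> 10}"

lemma norm_cis_diff_le: "norm (cis a - cis b) \<le> \<bar>a - b\<bar>"
proof -
  have "norm (cis a - cis b) = norm (cis b * (cis (a - b) - 1))"
    by (simp add: algebra_simps cis_mult)
  also have "\<dots> = norm (exp (\<i> * of_real (a - b)) - 1)"
    by (simp only: norm_mult cis_conv_exp norm_exp_i_times mult_1)
  also have "\<dots> = 2 * \<bar>sin ((a - b) / 2)\<bar>" by (rule dist_exp_i_1)
  also have "\<dots> \<le> \<bar>a - b\<bar>" using abs_sin_x_le_abs_x[of "(a - b) / 2"] by simp
  finally show ?thesis .
qed

lemma real_wave_mem:
  assumes "a\<^sup>2 + b\<^sup>2 + c\<^sup>2 = 2" "K \<subseteq> cylinder"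
  shows "(\<lambda>p. cis (a * Re (fst p) + b * Im (fst p) + c * snd p)) \<in> wclosure K"
  unfolding wclosure_def
proof (intro CollectI allI impI)
  fix e :: real assume e: "e > 0"
  \<comment> \<open>Three coordinates of size at most 10 turn frequency errors of
    \<open>e / 30\<close> into a phase error of at most \<open>e\<close>.\<close>
  then have "e / 30 > 0" by simp
  then obtain a' b' c' where r: "a' \<in> \<rat>" "b' \<in> \<rat>" "c' \<in> \<rat>" "a'\<^sup>2 + b'\<^sup>2 + c'\<^sup>2 = 2"
    and d: "\<bar>a - a'\<bar> < e / 30" "\<bar>b - b'\<bar> < e / 30" "\<bar>c - c'\<bar> < e / 30"
    using rational_points_on_sphere_dense[OF assms(1)] by metis
  show "\<exists>g\<in>waves. \<forall>p\<in>K. norm (cis (a * Re (fst p) + b * Im (fst p) + c * snd p) - g p) \<le> e"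
  proof (intro bexI[OF _ waves_cis[OF r]] ballI)
    fix p assume "p \<in> K"
    then have p: "\<bar>Re (fst p)\<bar> \<le> 10" "\<bar>Im (fst p)\<bar> \<le> 10" "\<bar>snd p\<bar> \<le> 10"
      using assms(2) abs_Re_le_cmod[of "fst p"] abs_Im_le_cmod[of "fst p"] unfolding cylinder_def by force+
    have "norm (cis (a * Re (fst p) + b * Im (fst p) + c * snd p) - cis (a' * Re (fst p) + b' * Im (fst p) + c' * snd p))
      \<le> \<bar>(a * Re (fst p) + b * Im (fst p) + c * snd p) - (a' * Re (fst p) + b' * Im (fst p) + c' * snd p)\<bar>"
      by (rule norm_cis_diff_le)
    also have "\<dots> = \<bar>(a - a') * Re (fst p) + (b - b') * Im (fst p) + (c - c') * snd p\<bar>"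
      by (simp add: algebra_simps)
    also have "\<dots> \<le> \<bar>a - a'\<bar> * \<bar>Re (fst p)\<bar> + \<bar>b - b'\<bar> * \<bar>Im (fst p)\<bar> + \<bar>c - c'\<bar> * \<bar>snd p\<bar>"
      unfolding abs_mult[symmetric] by linarith
    also have "\<dots> \<le> (e / 30) * 10 + (e / 30) * 10 + (e / 30) * 10"
      using p d e by (intro add_mono mult_mono) auto
    finally show "norm (cis (a * Re (fst p) + b * Im (fst p) + c * snd p) - cis (a' * Re (fst p) + b' * Im (fst p) + c' * snd p)) \<le> e"
      by simp
  qed
qed

section \<open>Complex frequencies\<close>

definition wavenumber :: complex where "wavenumber = of_real (sqrt 2)"

lemma norm_wavenumber: "norm wavenumber \<le> 2"
  unfolding wavenumber_def using real_sqrt_le_mono[of 2 4] by simp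

lemma cylinder_bounds:
  assumes "p \<in> cylinder" "norm u = 1"
  shows "\<bar>Re (cnj (fst p) * u)\<bar> \<le> 10" "\<bar>Im (cnj (fst p) * u)\<bar> \<le> 10" "\<bar>snd p\<bar> \<le> 10"
proof -
  have "norm (cnj (fst p) * u) \<le> 10" using assms by (simp add: cylinder_def norm_mult)
  then show "\<bar>Re (cnj (fst p) * u)\<bar> \<le> 10" "\<bar>Im (cnj (fst p) * u)\<bar> \<le> 10"
    using abs_Re_le_cmod[of "cnj (fst p) * u"] abs_Im_le_cmod[of "cnj (fst p) * u"] by linarith+
qed (use assms in \<open>simp add: cylinder_def\<close>)

text \<open>The plane waves with frequencies near a horizontal direction determined by \<open>u\<close>,
  parametrised by the two orthogonal components \<open>\<alpha>\<close>, \<open>\<beta>\<close> of the frequency.\<close>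

definition graph_wave :: "complex \<Rightarrow> complex \<Rightarrow> complex \<Rightarrow> complex \<times> real \<Rightarrow> complex" where
  "graph_wave u \<alpha> \<beta> p = exp (\<i> * (\<alpha> * of_real (Re (cnj (fst p) * u)) + \<beta> * of_real (snd p)
     + csqrt (2 - \<alpha>\<^sup>2 - \<beta>\<^sup>2) * of_real (Im (cnj (fst p) * u))))"

text \<open>The coefficient vector of this linear form is isotropic, so every
  \<open>exp (s * axial_coord u p)\<close> is harmonic. Multiplication by the exponential of
  \<open>transverse_phase\<close>, which varies in the orthogonal direction, gives a solution of the
  same Helmholtz equation for every complex \<open>s\<close>.\<close>

definition axial_coord :: "complex \<Rightarrow> complex \<times> real \<Rightarrow> complex" where
  "axial_coord u p = of_real (snd p) + \<i> * of_real (Re (cnj (fst p) * u))"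

definition transverse_phase :: "complex \<Rightarrow> complex \<times> real \<Rightarrow> complex" where
  "transverse_phase u p = \<i> * wavenumber * of_real (Im (cnj (fst p) * u))"

context
  fixes K :: "(complex \<times> real) set" and u :: complex
  assumes K: "K \<subseteq> cylinder" and u: "norm u = 1"
begin

text \<open>For real components the root is real, and passing from the axes adapted to
  \<open>u\<close> to the standard ones preserves the length of the frequency.\<close>

lemma graph_wave_real:
  fixes a b :: real
  assumes "\<bar>a\<bar> < 1 / 2" "\<bar>b\<bar> < 1 / 2"
  shows "graph_wave u (of_real a) (of_real b) \<in> wclosure K"
proof -
  define s where "s = sqrt (2 - a\<^sup>2 - b\<^sup>2)"
  have "\<bar>a\<bar>\<^sup>2 < (1 / 2)\<^sup>2" "\<bar>b\<bar>\<^sup>2 < (1 / 2)\<^sup>2"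
    using assms by (intro power_strict_mono; simp)+
  then have pos: "2 - a\<^sup>2 - b\<^sup>2 \<ge> 0" by (simp add: power2_eq_square)
  then have s2: "s\<^sup>2 = 2 - a\<^sup>2 - b\<^sup>2" by (simp add: s_def)
  have u2: "(Re u)\<^sup>2 + (Im u)\<^sup>2 = 1" using u by (simp add: cmod_def)
  have "(a * Re u + s * Im u)\<^sup>2 + (a * Im u - s * Re u)\<^sup>2 + b\<^sup>2 = (a\<^sup>2 + s\<^sup>2) * ((Re u)\<^sup>2 + (Im u)\<^sup>2) + b\<^sup>2"
    by (simp add: power2_eq_square algebra_simps)
  also have "\<dots> = 2" using s2 u2 by simp
  finally have 1: "(a * Re u + s * Im u)\<^sup>2 + (a * Im u - s * Re u)\<^sup>2 + b\<^sup>2 = 2" .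
  have "csqrt (2 - (of_real a)\<^sup>2 - (of_real b)\<^sup>2) = csqrt (of_real (2 - a\<^sup>2 - b\<^sup>2))" by simp
  also have "\<dots> = of_real s" unfolding s_def using pos by (rule of_real_sqrt[symmetric])
  finally have sq: "csqrt (2 - (of_real a)\<^sup>2 - (of_real b)\<^sup>2) = of_real s" .
  show ?thesis
  proof (rule wclosure.cong[OF real_wave_mem[OF 1 K]])
    fix p :: "complex \<times> real"
    have "graph_wave u (of_real a) (of_real b) p
      = cis (a * Re (cnj (fst p) * u) + b * snd p + s * Im (cnj (fst p) * u))"
      unfolding graph_wave_def sq cis_conv_exp by (simp only: of_real_add of_real_mult)
    also have "a * Re (cnj (fst p) * u) + b * snd p + s * Im (cnj (fst p) * u)
      = (a * Re u + s * Im u) * Re (fst p) + (a * Im u - s * Re u) * Im (fst p) + b * snd p"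
      by (simp add: algebra_simps)
    finally show "graph_wave u (of_real a) (of_real b) p
      = cis ((a * Re u + s * Im u) * Re (fst p) + (a * Im u - s * Re u) * Im (fst p) + b * snd p)" .
  qed
qed

text \<open>Keeps the argument of \<open>csqrt\<close> in the right half-plane, off the branch cut,
  so that \<open>graph_wave\<close> is holomorphic in either frequency.\<close>

lemma Re_graph_pos:
  fixes \<alpha> \<beta> :: complex
  assumes "norm \<alpha> < 1 / 2" "norm \<beta> < 1 / 2"
  shows "Re (2 - \<alpha>\<^sup>2 - \<beta>\<^sup>2) > 0" "norm (2 - \<alpha>\<^sup>2 - \<beta>\<^sup>2) \<le> 4"
proof -
  have "(norm \<alpha>)\<^sup>2 \<le> (1 / 2)\<^sup>2" "(norm \<beta>)\<^sup>2 \<le> (1 / 2)\<^sup>2"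
    using assms by (auto intro!: power_mono)
  then have n: "norm (\<alpha>\<^sup>2) \<le> 1 / 4" "norm (\<beta>\<^sup>2) \<le> 1 / 4"
    by (simp_all add: norm_power power_divide)
  show "Re (2 - \<alpha>\<^sup>2 - \<beta>\<^sup>2) > 0"
    using abs_Re_le_cmod[of "\<alpha>\<^sup>2"] abs_Re_le_cmod[of "\<beta>\<^sup>2"] n by (simp only: minus_complex.simps) simp
  show "norm (2 - \<alpha>\<^sup>2 - \<beta>\<^sup>2) \<le> 4"
    using norm_triangle_ineq4[of "2 - \<alpha>\<^sup>2" "\<beta>\<^sup>2"] norm_triangle_ineq4[of 2 "\<alpha>\<^sup>2"] n by simp
qed

lemma graph_wave_norm_le:
  assumes "norm \<alpha> < 1 / 2" "norm \<beta> < 1 / 2" "p \<in> K"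
  shows "norm (graph_wave u \<alpha> \<beta> p) \<le> exp 30"
proof -
  let ?c = "csqrt (2 - \<alpha>\<^sup>2 - \<beta>\<^sup>2)"
  note b = cylinder_bounds[OF subsetD[OF K \<open>p \<in> K\<close>] u]
  have "(norm ?c)\<^sup>2 \<le> 2\<^sup>2"
    using Re_graph_pos(2)[OF assms(1,2)] by (simp flip: norm_power)
  then have c: "norm ?c \<le> 2" by (rule power2_le_imp_le) simp
  have "norm (\<alpha> * of_real (Re (cnj (fst p) * u)) + \<beta> * of_real (snd p)
     + ?c * of_real (Im (cnj (fst p) * u))) \<le> (1 / 2) * 10 + (1 / 2) * 10 + 2 * 10"
    unfolding norm_mult[symmetric]
    by (intro norm_triangle_mono; simp only: norm_mult norm_of_real; intro mult_mono; use assms b c in force)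
  then show ?thesis
    unfolding graph_wave_def
    by (intro order_trans[OF norm_exp]) (simp add: norm_mult)
qed

lemma graph_wave_holomorphic1:
  assumes "norm \<beta> < 1 / 2"
  shows "(\<lambda>\<alpha>. graph_wave u \<alpha> \<beta> p) holomorphic_on ball 0 (1 / 2)"
proof -
  have "2 - \<alpha>\<^sup>2 - \<beta>\<^sup>2 \<notin> \<real>\<^sub>\<le>\<^sub>0" if "\<alpha> \<in> ball 0 (1 / 2)" for \<alpha>
    using Re_graph_pos(1)[of \<alpha> \<beta>] that assms by (auto simp: complex_nonpos_Reals_iff)
  then show ?thesis unfolding graph_wave_def by (intro holomorphic_intros) auto
qed

lemma graph_wave_holomorphic2:
  assumes "norm \<alpha> < 1 / 2"
  shows "(\<lambda>\<beta>. graph_wave u \<alpha> \<beta> p) holomorphic_on ball 0 (1 / 2)"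
proof -
  have "2 - \<alpha>\<^sup>2 - \<beta>\<^sup>2 \<notin> \<real>\<^sub>\<le>\<^sub>0" if "\<beta> \<in> ball 0 (1 / 2)" for \<beta>
    using Re_graph_pos(1)[of \<alpha> \<beta>] that assms by (auto simp: complex_nonpos_Reals_iff)
  then show ?thesis unfolding graph_wave_def by (intro holomorphic_intros) auto
qed

text \<open>One variable at a time: continuation in \<alpha> for real \<beta>, then in \<beta> for
  the complex \<alpha> just reached. Each continuation halves the radius \<open>1 / 2\<close> of
  analyticity.\<close>

lemma graph_wave_mem:
  assumes "norm \<alpha> < 1 / 4" "norm \<beta> < 1 / 4"
  shows "graph_wave u \<alpha> \<beta> \<in> wclosure K"
proof -
  have 1: "graph_wave u \<alpha> (of_real b) \<in> wclosure K" if b: "\<bar>b\<bar> < 1 / 2" for b :: real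
  proof (rule wclosure.continuation_mem[where c = 0 and r = "1 / 2" and d = "1 / 2" and B = "exp 30"
        and f = "\<lambda>\<alpha>. graph_wave u \<alpha> (of_real b)"])
    show "(\<lambda>\<alpha>. graph_wave u \<alpha> (of_real b) p) holomorphic_on ball 0 (1 / 2)" for p
      using b by (intro graph_wave_holomorphic1) simp
    show "norm (graph_wave u \<alpha> (of_real b) p) \<le> exp 30" if "p \<in> K" "\<alpha> \<in> ball 0 (1 / 2)" for p \<alpha>
      using that b by (intro graph_wave_norm_le) auto
    show "graph_wave u (0 + of_real a) (of_real b) \<in> wclosure K" if "\<bar>a\<bar> < 1 / 2" for a :: real
      using graph_wave_real[OF that b] by simp
  qed (use assms in auto)
  show ?thesis
  proof (rule wclosure.continuation_mem[where c = 0 and r = "1 / 2" and d = "1 / 2" and B = "exp 30"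
        and f = "\<lambda>\<beta>. graph_wave u \<alpha> \<beta>"])
    show "(\<lambda>\<beta>. graph_wave u \<alpha> \<beta> p) holomorphic_on ball 0 (1 / 2)" for p
      using assms by (intro graph_wave_holomorphic2) simp
    show "norm (graph_wave u \<alpha> \<beta> p) \<le> exp 30" if "p \<in> K" "\<beta> \<in> ball 0 (1 / 2)" for p \<beta>
      using that assms by (intro graph_wave_norm_le) auto
    show "graph_wave u \<alpha> (0 + of_real b) \<in> wclosure K" if "\<bar>b\<bar> < 1 / 2" for b :: real
      using 1[OF that] by simp
  qed (use assms in auto)
qed

section \<open>Isotropic complex frequencies and poles\<close>

lemma norm_axial_coord_le:
  assumes "p \<in> K"
  shows "norm (axial_coord u p) \<le> 20"
proof -
  note b = cylinder_bounds[OF subsetD[OF K assms] u]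
  have "norm (axial_coord u p) \<le> \<bar>snd p\<bar> + \<bar>Re (cnj (fst p) * u)\<bar>"
    unfolding axial_coord_def by (rule order_trans[OF norm_triangle_ineq]) (simp only: norm_mult norm_of_real norm_ii mult_1)
  then show ?thesis using b by linarith
qed

lemma norm_transverse_phase_le: "p \<in> K \<Longrightarrow> norm (transverse_phase u p) \<le> 20"
proof -
  assume "p \<in> K"
  then have "norm wavenumber * \<bar>Im (cnj (fst p) * u)\<bar> \<le> 2 * 10"
    using cylinder_bounds[OF _ u, of p] K norm_wavenumber by (intro mult_mono) auto
  then show ?thesis unfolding transverse_phase_def by (simp only: norm_mult norm_of_real norm_ii)
qed

lemma cwave_norm_le:
  assumes "p \<in> K"
  shows "norm (exp (s * axial_coord u p + transverse_phase u p)) \<le> exp (20 * norm s + 20)"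
proof -
  have "norm (s * axial_coord u p + transverse_phase u p) \<le> norm s * 20 + 20"
    using norm_axial_coord_le[OF assms] norm_transverse_phase_le[OF assms]
    by (intro norm_triangle_mono) (auto simp: norm_mult intro!: mult_left_mono)
  then show ?thesis by (intro order_trans[OF norm_exp]) simp
qed

text \<open>For \<open>\<alpha> = s\<close> and \<open>\<beta> = - \<i> * s\<close> the squares
  cancel, so the root in \<open>graph_wave\<close> is constantly \<open>wavenumber\<close> and the
  family is entire in \<open>s\<close>. Continuation from small real \<open>s\<close> therefore
  reaches every complex \<open>s\<close> at once.\<close>

lemma cwave_mem: "(\<lambda>p. exp (s * axial_coord u p + transverse_phase u p)) \<in> wclosure K"
proof (rule wclosure.continuation_mem[where c = 0 and r = "2 * norm s + 1" and d = "1 / 4"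
      and B = "exp (20 * (2 * norm s + 1) + 20)" and f = "\<lambda>s p. exp (s * axial_coord u p + transverse_phase u p)"])
  show "norm (exp (t * axial_coord u p + transverse_phase u p)) \<le> exp (20 * (2 * norm s + 1) + 20)"
    if "p \<in> K" "t \<in> ball 0 (2 * norm s + 1)" for p t
    using that by (intro order_trans[OF cwave_norm_le]) auto
  show "(\<lambda>p. exp ((0 + of_real h) * axial_coord u p + transverse_phase u p)) \<in> wclosure K" if "\<bar>h\<bar> < 1 / 4" for h :: real
  proof (rule wclosure.cong[OF graph_wave_mem])
    show "norm (of_real h :: complex) < 1 / 4" "norm (- \<i> * of_real h) < 1 / 4"
      using that by (simp_all add: norm_mult)
    fix p :: "complex \<times> real"
    have "csqrt (2 - (of_real h)\<^sup>2 - (- \<i> * of_real h)\<^sup>2) = csqrt (of_real 2)"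
      by (simp add: power_mult_distrib)
    also have "\<dots> = wavenumber" unfolding wavenumber_def by (subst of_real_sqrt) auto
    finally have c: "csqrt (2 - (of_real h)\<^sup>2 - (- \<i> * of_real h)\<^sup>2) = wavenumber" .
    show "exp ((0 + of_real h) * axial_coord u p + transverse_phase u p) = graph_wave u (of_real h) (- \<i> * of_real h) p"
      unfolding graph_wave_def c axial_coord_def transverse_phase_def by (simp add: algebra_simps)
  qed
qed (auto intro!: holomorphic_intros add_nonneg_pos)

text \<open>Each differentiation of the exponential in \<open>s\<close> brings down one factor
  \<open>axial_coord u p\<close>.\<close>

lemma poly_wave_mem: "(\<lambda>p. axial_coord u p ^ n * exp (s * axial_coord u p + transverse_phase u p)) \<in> wclosure K"
proof -
  have D: "(deriv ^^ n) (\<lambda>s. exp (s * axial_coord u p + transverse_phase u p)) = (\<lambda>s. axial_coord u p ^ n * exp (s * axial_coord u p + transverse_phase u p))" for p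
  proof (induction n)
    case (Suc n)
    have "((\<lambda>s. axial_coord u p ^ n * exp (s * axial_coord u p + transverse_phase u p)) has_field_derivative
        axial_coord u p ^ Suc n * exp (s * axial_coord u p + transverse_phase u p)) (at s)" for s
      by (rule derivative_eq_intros refl)+ (simp add: mult_ac)
    then show ?case
      by (simp only: funpow.simps comp_apply Suc.IH) (intro ext DERIV_imp_deriv)
  qed simp
  have "(\<lambda>p. (deriv ^^ n) (\<lambda>s. exp (s * axial_coord u p + transverse_phase u p)) (s + of_real 0)) \<in> wclosure K"
  proof (rule wclosure.deriv_mem[where r = 1 and d = 1 and B = "exp (20 * (norm s + 1) + 20)"
        and f = "\<lambda>s p. exp (s * axial_coord u p + transverse_phase u p)"])
    show "norm (exp (t * axial_coord u p + transverse_phase u p)) \<le> exp (20 * (norm s + 1) + 20)"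
      if "p \<in> K" "t \<in> ball s 1" for p t
    proof -
      have "norm t \<le> norm s + 1"
        using that norm_triangle_ineq2[of t s] by (simp add: dist_norm norm_minus_commute)
      then show ?thesis using that(1) by (intro order_trans[OF cwave_norm_le]) auto
    qed
  qed (auto intro!: holomorphic_intros cwave_mem)
  then show ?thesis unfolding D by simp
qed

text \<open>Expanding \<open>1 / (t - x)\<close> in powers of \<open>x / t\<close>, with
  \<open>x\<close> the axial coordinate, gives polynomial waves at
  \<open>s = - \<i> * wavenumber\<close>. As \<open>norm x \<le> 20\<close> on \<open>K\<close>, the
  hypothesis \<open>t > 21\<close> yields convergence and also
  \<open>norm (t - x) \<ge> 1\<close>.\<close>

lemma pole_wave_mem:
  fixes t :: real
  assumes t: "t > 21"
  shows "(\<lambda>p. exp (\<i> * wavenumber * (of_real t - axial_coord u p) + transverse_phase u p) / (of_real t - axial_coord u p)) \<in> wclosure K"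
proof (rule wclosure.lim)
  fix e :: real assume e: "e > 0"
  define q where "q = 20 / t"
  have q: "0 \<le> q" "q < 1" using t by (auto simp: q_def)
  define A where "A = exp (\<i> * wavenumber * of_real t)"
  define B where "B = norm A * exp (20 * norm (- \<i> * wavenumber) + 20)"
  have B: "B \<ge> 0" by (simp add: B_def)
  have "(\<lambda>n. B * q ^ n) \<longlonglongrightarrow> 0"
    using q by (intro tendsto_mult_right_zero LIMSEQ_realpow_zero) auto
  then have "eventually (\<lambda>n. B * q ^ n < e) sequentially" using e by (rule order_tendstoD(2))
  then obtain n where n: "B * q ^ n < e" by (auto dest: eventually_happens'[OF sequentially_bot])
  define g where "g = (\<lambda>p. \<Sum>i<n. (A / of_real t ^ Suc i) * (axial_coord u p ^ i * exp ((- \<i> * wavenumber) * axial_coord u p + transverse_phase u p)))"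
  have "wclosure K \<noteq> {}" using cwave_mem by blast
  then have "g \<in> wclosure K"
    unfolding g_def by (intro wclosure.sum_mem wclosure.scale poly_wave_mem)
  moreover have "norm (exp (\<i> * wavenumber * (of_real t - axial_coord u p) + transverse_phase u p) / (of_real t - axial_coord u p) - g p) \<le> e"
    if p: "p \<in> K" for p
  proof -
    let ?E = "exp ((- \<i> * wavenumber) * axial_coord u p + transverse_phase u p)" and ?x = "axial_coord u p / of_real t"
    have t0: "of_real t \<noteq> (0 :: complex)" using t by simp
    have nt: "norm (of_real t - axial_coord u p) \<ge> 1"
      using norm_axial_coord_le[OF p] norm_triangle_ineq2[of "of_real t" "axial_coord u p"] t by simp
    then have tz: "of_real t - axial_coord u p \<noteq> 0" by auto
    then have x1: "?x \<noteq> 1" using t0 by auto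
    have "g p = A * ?E / of_real t * (\<Sum>i<n. ?x ^ i)"
      unfolding g_def sum_distrib_left by (intro sum.cong refl) (simp add: power_divide)
    also have "(\<Sum>i<n. ?x ^ i) = (1 - ?x ^ n) / (1 - ?x)"
      by (simp only: sum_gp_strict x1 if_False)
    also have "A * ?E / of_real t * ((1 - ?x ^ n) / (1 - ?x)) = A * ?E / (of_real t - axial_coord u p) * (1 - ?x ^ n)"
      using t0 tz x1 by (simp add: divide_simps)
    finally have gp: "g p = A * ?E / (of_real t - axial_coord u p) * (1 - ?x ^ n)" .
    have "exp (\<i> * wavenumber * (of_real t - axial_coord u p) + transverse_phase u p) = A * ?E"
      unfolding A_def exp_add[symmetric] by (simp add: algebra_simps)
    then have "exp (\<i> * wavenumber * (of_real t - axial_coord u p) + transverse_phase u p) / (of_real t - axial_coord u p) - g p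
      = A * ?E / (of_real t - axial_coord u p) * ?x ^ n"
      by (simp only: gp right_diff_distrib mult_1_right diff_diff_eq2 add_diff_cancel_left')
    then have "norm (exp (\<i> * wavenumber * (of_real t - axial_coord u p) + transverse_phase u p) / (of_real t - axial_coord u p) - g p)
      = norm A * norm ?E / norm (of_real t - axial_coord u p) * norm ?x ^ n"
      by (simp only: norm_mult norm_divide norm_power)
    also have "\<dots> \<le> (norm A * exp (20 * norm (- \<i> * wavenumber) + 20) / 1) * q ^ n"
    proof (intro mult_mono frac_le power_mono)
      show "norm ?x \<le> q" unfolding q_def norm_divide
        using norm_axial_coord_le[OF p] t by (simp add: divide_right_mono)
      show "norm ?E \<le> exp (20 * norm (- \<i> * wavenumber) + 20)" by (rule cwave_norm_le[OF p])
    qed (use nt in auto)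
    also have "\<dots> \<le> e" using n by (simp add: B_def)
    finally show ?thesis .
  qed
  ultimately show "\<exists>g\<in>wclosure K. \<forall>p\<in>K. norm (exp (\<i> * wavenumber * (of_real t - axial_coord u p) + transverse_phase u p) / (of_real t - axial_coord u p) - g p) \<le> e"
    by (intro bexI[of _ g]) auto
qed

end

section \<open>Point sources\<close>

text \<open>The integrand is a rational function times an exponential of \<open>v = exp (2 \<pi> \<i> s)\<close>; of its two
  poles \<open>v\<^sub>1\<close>, \<open>v\<^sub>2\<close> only \<open>v\<^sub>1\<close> lies in the unit disc.\<close>

lemma spherical_wave_average:
  fixes c k :: complex and h :: real
  assumes c: "c \<noteq> 0" and h: "h > 0"
  defines "r \<equiv> sqrt (h\<^sup>2 + (norm c)\<^sup>2)" and "u \<equiv> \<lambda>s::real. exp (2 * of_real pi * \<i> * of_real s)"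
  shows "((\<lambda>s. exp (\<i> * k * (of_real h - \<i> * c * u s)) / (of_real h - \<i> * of_real (Re (c * u s))))
     has_integral exp (\<i> * k * of_real r) / of_real r) {0..1}"
proof -
  \<comment> \<open>Since \<open>cnj v = 1 / v\<close> on the unit circle,
    \<open>v * (h - \<i> * Re (c * v))\<close> is there a quadratic polynomial in \<open>v\<close>
    with roots \<open>v1\<close> and \<open>v2\<close>. The function \<open>f\<close> retains only
    the factor of \<open>v2\<close>, which leaves a Cauchy integral of \<open>f\<close> at
    \<open>v1\<close>.\<close>
  define v1 where "v1 = \<i> * of_real (r - h) / c"
  define v2 where "v2 = - \<i> * of_real (r + h) / c"
  define f where "f = (\<lambda>v. exp (\<i> * k * (of_real h - \<i> * c * v)) / (- (\<i> * c / 2) * (v - v2)))"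
  have nc: "norm c > 0" using c by simp
  have r2: "r\<^sup>2 = h\<^sup>2 + (norm c)\<^sup>2" by (simp add: r_def)
  have r0: "r > 0" unfolding r_def using h by (intro real_sqrt_gt_zero add_pos_nonneg) auto
  have "h < r" unfolding r_def using h nc by (intro real_less_rsqrt) simp
  moreover have "r < h + norm c"
    unfolding r_def using h nc by (intro real_less_lsqrt) (auto simp: power2_eq_square algebra_simps)
  ultimately have n1: "norm (v1 - 0) < 1" and n2: "norm v2 > 1"
    using nc h c r0 r2
    by (simp_all only: v1_def v2_def norm_divide norm_mult norm_of_real diff_0_right norm_minus_cancel norm_ii)
      (simp_all add: divide_less_eq less_divide_eq, smt (verit) power2_less_imp_less real_sqrt_abs zero_le_power2 power_strict_mono)
  have "f holomorphic_on cball 0 1"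
    unfolding f_def using n2 c by (intro holomorphic_intros) auto
  from Cauchy_integral_circlepath_simple[OF this n1]
  have int: "((\<lambda>s. f (u s) / (u s - v1) * (2 * of_real pi * \<i> * u s)) has_integral 2 * of_real pi * \<i> * f v1) {0..1}"
    unfolding has_contour_integral_def
    by (rule has_integral_eq[rotated]) (simp add: vector_derivative_circlepath01, simp add: circlepath u_def)
  have fv1: "f v1 = exp (\<i> * k * of_real r) / of_real r"
  proof -
    have "of_real h - \<i> * c * v1 = of_real r" using c by (simp add: v1_def field_simps)
    moreover have "- (\<i> * c / 2) * (v1 - v2) = of_real r"
      using c by (simp add: v1_def v2_def field_simps)
    ultimately show ?thesis unfolding f_def by simp
  qed
  have eq: "f (u s) / (u s - v1) * (2 * of_real pi * \<i> * u s)
    = 2 * of_real pi * \<i> * (exp (\<i> * k * (of_real h - \<i> * c * u s)) / (of_real h - \<i> * of_real (Re (c * u s))))" for s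
  proof -
    let ?v = "u s"
    have v: "norm ?v = 1" by (simp add: u_def)
    then have v0: "?v \<noteq> 0" by auto
    have vc: "cnj ?v * ?v = 1" using complex_norm_square[of ?v] v by (simp add: mult.commute)
    have cc: "of_real ((norm c)\<^sup>2) = c * cnj c" by (rule complex_norm_square)
    have sum: "c * (v1 + v2) = - 2 * \<i> * of_real h" using c by (simp add: v1_def v2_def field_simps)
    have "c * c * (v1 * v2) = of_real (r\<^sup>2 - h\<^sup>2)"
      using c by (simp add: v1_def v2_def field_simps power2_eq_square)
    also have "\<dots> = c * cnj c" unfolding r2 using cc by simp
    finally have prod: "c * (v1 * v2) = cnj c" using c by simp
    have "- (\<i> * c / 2) * (?v - v2) * (?v - v1) = - (\<i> / 2) * (c * ?v\<^sup>2 - c * (v1 + v2) * ?v + c * (v1 * v2))"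
      by (simp add: power2_eq_square field_simps)
    also have "\<dots> = - (\<i> / 2) * (c * ?v\<^sup>2 + cnj c * (cnj ?v * ?v)) + of_real h * ?v"
      unfolding sum prod vc by (simp add: field_simps)
    also have "\<dots> = ?v * (of_real h - \<i> * ((c * ?v + cnj (c * ?v)) / 2))"
      by (simp add: power2_eq_square field_simps)
    also have "(c * ?v + cnj (c * ?v)) / 2 = of_real (Re (c * ?v))"
      by (simp only: complex_add_cnj) simp
    finally have d: "- (\<i> * c / 2) * (?v - v2) * (?v - v1) = ?v * (of_real h - \<i> * of_real (Re (c * ?v)))" .
    have "f ?v / (?v - v1) = exp (\<i> * k * (of_real h - \<i> * c * ?v)) / (?v * (of_real h - \<i> * of_real (Re (c * ?v))))"
      unfolding f_def divide_divide_eq_left d ..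
    then show ?thesis using v0 by (simp only: divide_divide_eq_left[symmetric]) simp
  qed
  have "((\<lambda>s. (1 / (2 * of_real pi * \<i>)) * (f (u s) / (u s - v1) * (2 * of_real pi * \<i> * u s)))
    has_integral (1 / (2 * of_real pi * \<i>)) * (2 * of_real pi * \<i> * f v1)) {0..1}"
    by (rule has_integral_mult_right[OF int])
  then show ?thesis unfolding eq fv1 by simp
qed

text \<open>For real \<open>t\<close> this is the spherical wave emitted from the point \<open>(0, 0, t)\<close>; it is analytic in
  complex \<open>t\<close> near the real line as long as the distance to the axis stays positive.\<close>

definition source :: "complex \<Rightarrow> complex \<times> real \<Rightarrow> complex" where
  "source t p = (let R = csqrt (of_real ((norm (fst p))\<^sup>2) + (of_real (snd p) - t)\<^sup>2) in exp (\<i> * wavenumber * R) / R)"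

lemma source_of_real:
  "source (of_real t) p = (let r = sqrt ((norm (fst p))\<^sup>2 + (snd p - t)\<^sup>2) in cis (sqrt 2 * r) / of_real r)"
proof -
  have "csqrt (of_real ((norm (fst p))\<^sup>2) + (of_real (snd p) - of_real t)\<^sup>2)
    = csqrt (of_real ((norm (fst p))\<^sup>2 + (snd p - t)\<^sup>2))" by simp
  also have "\<dots> = of_real (sqrt ((norm (fst p))\<^sup>2 + (snd p - t)\<^sup>2))"
    by (rule csqrt_of_real) simp
  finally show ?thesis
    unfolding source_def Let_def cis_conv_exp wavenumber_def by (simp add: mult.assoc)
qed

text \<open>By \<open>spherical_wave_average\<close> with \<open>c = cnj (fst p)\<close> the source
  is the mean of the pole waves over all horizontal directions \<open>u\<close>. As \<open>t\<close>
  lies above the cylinder, none of them has a pole there.\<close>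

lemma source_far_mem:
  fixes t :: real
  assumes t: "t > 21" and K: "K \<subseteq> cylinder" and nz: "\<And>p. p \<in> K \<Longrightarrow> fst p \<noteq> 0"
  shows "source (of_real t) \<in> wclosure K"
proof -
  define u where "u = (\<lambda>s::real. exp (2 * of_real pi * \<i> * of_real s))"
  have u: "norm (u s) = 1" for s by (simp add: u_def)
  define F where "F = (\<lambda>s p. exp (\<i> * wavenumber * (of_real t - axial_coord (u s) p) + transverse_phase (u s) p) / (of_real t - axial_coord (u s) p))"
  \<comment> \<open>The axial coordinate supplies the real part and the transverse phase the
    imaginary part of \<open>cnj (fst p) * u s\<close>, so the exponent becomes holomorphic in
    \<open>u s\<close>; the denominator contains the real part only.\<close>
  have F: "F s p = exp (\<i> * wavenumber * (of_real (t - snd p) - \<i> * cnj (fst p) * u s))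
      / (of_real (t - snd p) - \<i> * of_real (Re (cnj (fst p) * u s)))" for s p
  proof -
    have "cnj (fst p) * u s = of_real (Re (cnj (fst p) * u s)) + \<i> * of_real (Im (cnj (fst p) * u s))"
      by (rule complex_eq)
    then have "\<i> * wavenumber * (of_real (t - snd p) - \<i> * cnj (fst p) * u s)
      = \<i> * wavenumber * (of_real (t - snd p) - \<i> * (of_real (Re (cnj (fst p) * u s)) + \<i> * of_real (Im (cnj (fst p) * u s))))"
      by (simp only: mult.assoc)
    also have "\<dots> = \<i> * wavenumber * (of_real t - axial_coord (u s) p) + transverse_phase (u s) p"
      unfolding axial_coord_def transverse_phase_def of_real_diff by (simp add: ring_distribs)
    finally show ?thesis
      unfolding F_def by (simp only: axial_coord_def of_real_diff diff_diff_eq)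
  qed
  have pos: "t - snd p > 0" if "p \<in> cylinder" for p
    using that t abs_le_D1[of "snd p" 10] by (auto simp: cylinder_def)
  show ?thesis
  proof (rule wclosure.Riemann_sum_mem[where f = F])
    show "F s \<in> wclosure K" for s
      unfolding F_def by (rule pole_wave_mem[OF K u t])
    show "((\<lambda>s. F s p) has_integral source (of_real t) p) {0..1}" if p: "p \<in> K" for p
    proof -
      have "cnj (fst p) \<noteq> 0" "t - snd p > 0" using nz[OF p] pos[OF subsetD[OF K p]] by simp_all
      from spherical_wave_average[OF this, of wavenumber] show ?thesis
        unfolding F source_of_real Let_def cis_conv_exp u_def
        by (simp add: wavenumber_def power2_commute[of t] add.commute mult.assoc)
    qed
    show "\<exists>d>0. \<forall>p\<in>K. \<forall>s\<in>{0..1}. \<forall>s'\<in>{0..1}. \<bar>s - s'\<bar> < d \<longrightarrow> norm (F s p - F s' p) \<le> e"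
      if e: "e > 0" for e
    proof -
      have cyl: "cylinder = cball 0 10 \<times> cball 0 10" by (auto simp: cylinder_def)
      have "compact cylinder" unfolding cyl by (intro compact_Times compact_cball)
      then have "compact ({0..1::real} \<times> cylinder)" by (intro compact_Times compact_Icc)
      moreover have "continuous_on ({0..1} \<times> cylinder) (\<lambda>q. F (fst q) (snd q))"
        unfolding F u_def
      proof (intro continuous_intros ballI)
        fix q :: "real \<times> complex \<times> real" assume "q \<in> {0..1} \<times> cylinder"
        then have "t - snd (snd q) > 0" using pos by auto
        then show "of_real (t - snd (snd q)) - \<i> * of_real (Re (cnj (fst (snd q)) * exp (2 * of_real pi * \<i> * of_real (fst q)))) \<noteq> 0"
          by (auto simp: complex_eq_iff)
      qed
      ultimately have "uniformly_continuous_on ({0..1} \<times> cylinder) (\<lambda>q. F (fst q) (snd q))"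
        by (intro compact_uniformly_continuous)
      then obtain d where d: "d > 0"
        and dd: "\<And>q q'. q \<in> {0..1} \<times> cylinder \<Longrightarrow> q' \<in> {0..1} \<times> cylinder \<Longrightarrow> dist q' q < d
          \<Longrightarrow> dist (F (fst q') (snd q')) (F (fst q) (snd q)) < e"
        using e unfolding uniformly_continuous_on_def by metis
      show ?thesis
      proof (intro exI[of _ d] conjI d ballI impI)
        fix p s s' assume *: "p \<in> K" "s \<in> {0..1::real}" "s' \<in> {0..1::real}" "\<bar>s - s'\<bar> < d"
        have "dist (s, p) (s', p) < d" using *(4) by (simp add: dist_Pair_Pair dist_real_def)
        then show "norm (F s p - F s' p) \<le> e"
          using dd[of "(s', p)" "(s, p)"] * K by (auto simp: dist_norm less_imp_le)
      qed
    qed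
  qed
qed

text \<open>Pole pushing: a source beyond the cylinder is a regular solution on the cylinder, and by
  analytic continuation in \<open>t\<close> the source can be moved along the axis into the cylinder.\<close>

lemma source_mem:
  fixes t :: real
  assumes \<eta>: "\<eta> > 0" and K: "K \<subseteq> cylinder" and K\<eta>: "\<And>p. p \<in> K \<Longrightarrow> norm (fst p) \<ge> \<eta>"
  shows "source (of_real t) \<in> wclosure K"
proof -
  \<comment> \<open>While \<open>\<bar>Im t\<bar> \<le> \<eta> / 2\<close>, the squared distance
    \<open>q t p\<close> has positive real part, so the source is analytic in \<open>t\<close> on a
    disc of radius \<open>\<eta> / 2\<close>, and membership near \<open>c\<close> spreads to radius
    \<open>\<eta> / 4\<close>.\<close>
  have step: "source (of_real t) \<in> wclosure K"
    if mem: "\<And>h. \<bar>h\<bar> < \<eta> / 16 \<Longrightarrow> source (of_real (c + h)) \<in> wclosure K" and t: "\<bar>t - c\<bar> < \<eta> / 4"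
    for c t :: real
  proof -
    define q where "q t p = of_real ((norm (fst p))\<^sup>2) + (of_real (snd p) - t)\<^sup>2" for t :: complex and p :: "complex \<times> real"
    define Q where "Q = 10\<^sup>2 + (10 + \<bar>c\<bar> + \<eta>)\<^sup>2"
    have Im_t: "\<bar>Im t\<bar> \<le> \<eta> / 2" if "t \<in> ball (of_real c) (\<eta> / 2)" for t :: complex
      using abs_Im_le_cmod[of "of_real c - t"] that by (simp add: dist_norm)
    have Re_q: "Re (q t p) \<ge> (\<eta> / 2)\<^sup>2" if p: "p \<in> K" and t: "t \<in> ball (of_real c) (\<eta> / 2)" for p t
    proof -
      have "(Im t)\<^sup>2 \<le> (\<eta> / 2)\<^sup>2" using power_mono[OF Im_t[OF t], of 2] by simp
      moreover have "\<eta>\<^sup>2 \<le> (norm (fst p))\<^sup>2" using K\<eta>[OF p] \<eta> by (intro power_mono) auto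
      moreover have "Re (q t p) = (norm (fst p))\<^sup>2 + (snd p - Re t)\<^sup>2 - (Im t)\<^sup>2"
        by (simp add: q_def power2_eq_square)
      moreover have "(\<eta> / 2)\<^sup>2 + (\<eta> / 2)\<^sup>2 \<le> \<eta>\<^sup>2" by (simp add: power2_eq_square)
      ultimately show ?thesis using zero_le_power2[of "snd p - Re t"] by linarith
    qed
    have norm_q: "norm (q t p) \<le> Q" if p: "p \<in> K" and t: "t \<in> ball (of_real c) (\<eta> / 2)" for p t
    proof -
      have "norm (fst p) \<le> 10" "\<bar>snd p\<bar> \<le> 10" using p K by (auto simp: cylinder_def)
      moreover have "norm t \<le> \<bar>c\<bar> + \<eta>"
        using norm_triangle_ineq2[of t "of_real c"] t \<eta> by (simp add: dist_norm norm_minus_commute)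
      ultimately have "norm (of_real (snd p) - t) \<le> 10 + \<bar>c\<bar> + \<eta>" "norm (fst p) \<le> 10"
        using norm_triangle_ineq4[of "of_real (snd p)" t] by auto
      then have "norm (fst p) ^ 2 \<le> 10\<^sup>2" "norm (of_real (snd p) - t) ^ 2 \<le> (10 + \<bar>c\<bar> + \<eta>)\<^sup>2"
        by (intro power_mono; simp)+
      then show ?thesis unfolding q_def Q_def
        by (intro norm_triangle_mono) (simp_all add: norm_power)
    qed
    show ?thesis
    proof (rule wclosure.continuation_mem[where f = source and c = "of_real c" and r = "\<eta> / 2" and d = "\<eta> / 16"
          and B = "exp (2 * sqrt Q) / (\<eta> / 2)"])
      fix p assume p: "p \<in> K"
      have nn: "q t p \<notin> \<real>\<^sub>\<le>\<^sub>0" if "t \<in> ball (of_real c) (\<eta> / 2)" for t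
      proof -
        have "(\<eta> / 2)\<^sup>2 > 0" using \<eta> by simp
        then have "Re (q t p) > 0" using Re_q[OF p that] by linarith
        then show ?thesis by (auto simp: complex_nonpos_Reals_iff)
      qed
      then have "q t p \<noteq> 0" if "t \<in> ball (of_real c) (\<eta> / 2)" for t using that by force
      then show "(\<lambda>t. source t p) holomorphic_on ball (of_real c) (\<eta> / 2)"
        using nn unfolding source_def Let_def q_def by (intro holomorphic_intros) auto
      fix t :: complex assume t: "t \<in> ball (of_real c) (\<eta> / 2)"
      have "(\<eta> / 2)\<^sup>2 \<le> norm (q t p)"
        using Re_q[OF p t] complex_Re_le_cmod[of "q t p"] by linarith
      then have "\<eta> / 2 \<le> norm (csqrt (q t p))" 
        unfolding norm_csqrt by (rule real_le_rsqrt)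
      moreover have "norm (exp (\<i> * wavenumber * csqrt (q t p))) \<le> exp (2 * sqrt Q)"
      proof -
        have "norm wavenumber * sqrt (norm (q t p)) \<le> 2 * sqrt Q"
          using norm_q[OF p t] norm_wavenumber by (intro mult_mono) auto
        then show ?thesis by (intro order_trans[OF norm_exp]) (simp add: norm_mult)
      qed
      ultimately show "norm (source t p) \<le> exp (2 * sqrt Q) / (\<eta> / 2)"
        unfolding source_def Let_def q_def[symmetric] norm_divide using \<eta> by (intro frac_le) auto
    qed (use mem t \<eta> in \<open>auto simp: dist_norm abs_minus_commute simp flip: of_real_add of_real_diff\<close>)
  qed
  have "source (of_real t) \<in> wclosure K" if "22 - real n * (\<eta> / 8) < t" for n and t :: real
    using that
  proof (induction n arbitrary: t)
    case 0
    show ?case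
    proof (rule source_far_mem)
      show "fst p \<noteq> 0" if "p \<in> K" for p using K\<eta>[OF that] \<eta> by auto
    qed (use 0 K in auto)
  next
    case (Suc n)
    show ?case
    proof (cases "22 - real n * (\<eta> / 8) < t")
      case False
      \<comment> \<open>The segment of radius \<open>\<eta> / 16\<close> about \<open>c\<close> lies
        just above the threshold already reached, and \<open>t\<close> is less than
        \<open>3 * \<eta> / 16\<close> below \<open>c\<close>.\<close>
      define c where "c = 22 - real n * (\<eta> / 8) + \<eta> / 16"
      have "22 - real n * (\<eta> / 8) - \<eta> / 8 < t" using Suc.prems by (simp add: field_simps)
      then have "\<bar>t - c\<bar> < \<eta> / 4" using False \<eta> unfolding c_def by linarith
      moreover have "source (of_real (c + h)) \<in> wclosure K" if "\<bar>h\<bar> < \<eta> / 16" for h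
        using that by (intro Suc.IH) (auto simp: c_def)
      ultimately show ?thesis using step[of c t] by blast
    qed (rule Suc.IH)
  qed
  moreover obtain n :: nat where "(22 - t) / (\<eta> / 8) < real n" using reals_Archimedean2 by blast
  then have "22 - real n * (\<eta> / 8) < t" using \<eta> by (simp add: divide_less_eq)
  ultimately show ?thesis by blast
qed

section \<open>Tubes\<close>

lemma cos_sqrt2_nonneg: "0 \<le> r \<Longrightarrow> r \<le> 1 \<Longrightarrow> 0 \<le> cos (sqrt 2 * r)"
proof -
  assume r: "0 \<le> r" "r \<le> 1"
  have "sqrt 2 < 3 / 2" by (rule real_less_lsqrt) (auto simp: power2_eq_square)
  moreover have "sqrt 2 * r \<le> sqrt 2" using r by (simp add: mult_left_le)
  ultimately have "sqrt 2 * r \<le> pi / 2" using pi_gt3 by linarith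
  moreover have "0 \<le> sqrt 2 * r" using r by simp
  ultimately show ?thesis using pi_gt_zero by (intro cos_ge_zero) linarith+
qed

lemma cos_sqrt2_ge_half: "0 \<le> r \<Longrightarrow> r \<le> 1 / 2 \<Longrightarrow> 1 / 2 \<le> cos (sqrt 2 * r)"
proof -
  assume r: "0 \<le> r" "r \<le> 1 / 2"
  have "sqrt 2 < 3 / 2" by (rule real_less_lsqrt) (auto simp: power2_eq_square)
  moreover have "sqrt 2 * r \<le> sqrt 2 * (1 / 2)" using r by (intro mult_left_mono) auto
  ultimately have "sqrt 2 * r \<le> pi / 3" using pi_gt3 by linarith
  then have "cos (pi / 3) \<le> cos (sqrt 2 * r)" using r by (intro cos_monotone_0_pi_le) auto
  then show ?thesis by (simp add: cos_60)
qed

text \<open>Each term dominates \<open>ln (1 + \<eta> / x)\<close>, and these logarithms telescope.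
  This produces the logarithmic growth near a line of sources.\<close>

lemma sum_reciprocal_ge_ln:
  fixes a \<eta> :: real
  assumes "a > 0" "\<eta> > 0"
  shows "ln ((a + (real M + 1) * \<eta>) / (a + \<eta>)) \<le> (\<Sum>m<M. \<eta> / (a + (real m + 1) * \<eta>))"
proof (induction M)
  case (Suc M)
  let ?x = "a + (real M + 1) * \<eta>"
  have "(real M + 1) * \<eta> > 0" using assms by (intro mult_pos_pos) auto
  then have x: "?x > 0" "a + \<eta> > 0" using assms by linarith+
  have "ln ((a + (real (Suc M) + 1) * \<eta>) / (a + \<eta>)) = ln (1 + \<eta> / ?x) + ln (?x / (a + \<eta>))"
  proof -
    have "a + (real (Suc M) + 1) * \<eta> = (1 + \<eta> / ?x) * ?x"
      using x by (simp add: distrib_right)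
    then have "(a + (real (Suc M) + 1) * \<eta>) / (a + \<eta>) = (1 + \<eta> / ?x) * (?x / (a + \<eta>))"
      by simp
    moreover have "1 + \<eta> / ?x > 0" "?x / (a + \<eta>) > 0" using x assms by (auto intro!: add_pos_pos)
    ultimately show ?thesis by (simp only: ln_mult_pos)
  qed
  also have "\<dots> \<le> \<eta> / ?x + (\<Sum>m<M. \<eta> / (a + (real m + 1) * \<eta>))"
    using x assms by (intro add_mono Suc.IH ln_add_one_self_le_self) auto
  finally show ?case by simp
qed (use assms in simp)

lemma Re_source: "Re (source (of_real t) p)
  = cos (sqrt 2 * sqrt ((norm (fst p))\<^sup>2 + (snd p - t)\<^sup>2)) / sqrt ((norm (fst p))\<^sup>2 + (snd p - t)\<^sup>2)"
  by (simp add: source_of_real Let_def)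

text \<open>For \<open>r \<le> 1\<close> the cosine is non-negative, and beyond that
  \<open>1 / r\<close> is at most 1. So the lower bound, unlike the upper one, does not deteriorate
  near the axis.\<close>

lemma Re_source_bounds:
  assumes "fst p \<noteq> 0"
  shows "- 1 \<le> Re (source (of_real t) p)" "Re (source (of_real t) p) \<le> 1 / norm (fst p)"
proof -
  define r where "r = sqrt ((norm (fst p))\<^sup>2 + (snd p - t)\<^sup>2)"
  have r: "norm (fst p) \<le> r" unfolding r_def by (rule real_sqrt_sum_squares_ge1)
  have n: "norm (fst p) > 0" using assms by simp
  then have r0: "r > 0" using r by linarith
  have eq: "Re (source (of_real t) p) = cos (sqrt 2 * r) / r" by (simp add: Re_source r_def)
  show "- 1 \<le> Re (source (of_real t) p)"
  proof (cases "r \<le> 1")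
    case True
    then have "0 \<le> cos (sqrt 2 * r) / r" using r0 cos_sqrt2_nonneg[of r] by simp
    then show ?thesis unfolding eq by linarith
  next
    case False
    then have "- r \<le> cos (sqrt 2 * r)" using cos_ge_minus_one[of "sqrt 2 * r"] by linarith
    then show ?thesis unfolding eq using r0 by (simp add: le_divide_eq)
  qed
  show "Re (source (of_real t) p) \<le> 1 / norm (fst p)"
    unfolding eq using r n by (intro frac_le) auto
qed

lemma Re_source_ge:
  assumes "fst p \<noteq> 0" "\<bar>snd p - t\<bar> \<le> b" "norm (fst p) + b \<le> 1 / 2"
  shows "1 / (2 * (norm (fst p) + b)) \<le> Re (source (of_real t) p)"
proof -
  define r where "r = sqrt ((norm (fst p))\<^sup>2 + (snd p - t)\<^sup>2)"
  have "norm (fst p) \<le> r" unfolding r_def by (rule real_sqrt_sum_squares_ge1)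
  moreover have "norm (fst p) > 0" using assms by simp
  ultimately have r0: "r > 0" by linarith
  have "r \<le> norm (fst p) + \<bar>snd p - t\<bar>"
    unfolding r_def using sqrt_sum_squares_le_sum_abs[of "norm (fst p)" "snd p - t"] by simp
  then have r1: "r \<le> norm (fst p) + b" using assms(2) by linarith
  have "1 / (2 * (norm (fst p) + b)) = (1 / 2) / (norm (fst p) + b)" by simp
  also have "\<dots> \<le> cos (sqrt 2 * r) / r"
    using r0 r1 assms(3) cos_sqrt2_ge_half[of r] by (intro frac_le) auto
  finally show ?thesis by (simp add: Re_source r_def)
qed

text \<open>The approximated function is a sum of equally spaced point sources along the axis, which
  behaves like the potential of a uniformly charged segment.\<close>

lemma tube_wave_exists:
  assumes \<eta>: "0 < \<eta>" "\<eta> \<le> 1 / 8"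
  obtains v where "v \<in> waves"
    "\<And>p. \<lbrakk>\<eta> \<le> norm (fst p); norm (fst p) \<le> 10; \<bar>snd p\<bar> \<le> 4\<rbrakk> \<Longrightarrow> - 16 \<le> Re (v p)"
    "\<And>p. \<lbrakk>\<eta> \<le> norm (fst p); norm (fst p) \<le> 10; \<bar>snd p\<bar> \<le> 4\<rbrakk> \<Longrightarrow> Re (v p) \<le> 16 / norm (fst p) + 16"
    "\<And>p. \<lbrakk>\<eta> \<le> norm (fst p); norm (fst p) \<le> 10; \<bar>snd p\<bar> \<le> 4\<rbrakk> \<Longrightarrow> ln (1 / norm (fst p)) / 2 - 16 \<le> Re (v p)"
proof -
  define K where "K = {p :: complex \<times> real. \<eta> \<le> norm (fst p) \<and> norm (fst p) \<le> 10 \<and> \<bar>snd p\<bar> \<le> 4}"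
  \<comment> \<open>Sources up to height 5 cover the heights up to 4, with room for those slightly
    above the point that enter the logarithmic bound.\<close>
  define J where "J = \<lceil>5 / \<eta>\<rceil>"
  define W where "W = (\<lambda>p. \<Sum>j\<in>{-J..J}. of_real \<eta> * source (of_real (of_int j * \<eta>)) p)"
  have KC: "K \<subseteq> cylinder" unfolding K_def cylinder_def by auto
  have mem: "source (of_real t) \<in> wclosure K" for t
    by (rule source_mem[OF \<eta>(1) KC]) (simp add: K_def)
  then have "wclosure K \<noteq> {}" by blast
  then have "W \<in> wclosure K" unfolding W_def by (intro wclosure.sum_mem wclosure.scale mem)
  then obtain v where v: "v \<in> waves" "\<And>p. p \<in> K \<Longrightarrow> norm (W p - v p) \<le> 1"
    unfolding wclosure_def using zero_less_one by blast
  have vW: "Re (W p) - 1 \<le> Re (v p)" "Re (v p) \<le> Re (W p) + 1" if "p \<in> K" for p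
    using v(2)[OF that] abs_Re_le_cmod[of "W p - v p"] by auto
  have J: "5 \<le> real_of_int J * \<eta>" "real_of_int J * \<eta> < 5 + \<eta>"
  proof -
    have "5 / \<eta> \<le> real_of_int J" "real_of_int J < 5 / \<eta> + 1" unfolding J_def by linarith+
    then show "5 \<le> real_of_int J * \<eta>" "real_of_int J * \<eta> < 5 + \<eta>"
      using \<eta> by (simp_all add: field_simps)
  qed
  have "0 \<le> 5 / \<eta>" using \<eta> by simp
  then have J0: "J \<ge> 0" unfolding J_def by linarith
  have len: "(\<Sum>j\<in>{-J..J}. \<eta>) \<le> 11"
  proof -
    have "(\<Sum>j\<in>{-J..J}. \<eta>) = 2 * (real_of_int J * \<eta>) + \<eta>"
      using J0 by (simp add: algebra_simps)
    then show ?thesis using J \<eta> by linarith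
  qed
  have ReW: "Re (W p) = (\<Sum>j\<in>{-J..J}. \<eta> * Re (source (of_real (of_int j * \<eta>)) p))" for p
    unfolding W_def by simp
  show thesis
  proof (rule that[OF v(1)])
    fix p :: "complex \<times> real"
    assume p: "\<eta> \<le> norm (fst p)" "norm (fst p) \<le> 10" "\<bar>snd p\<bar> \<le> 4"
    then have pK: "p \<in> K" by (simp add: K_def)
    have n: "norm (fst p) > 0" using p \<eta> by linarith
    then have nz: "fst p \<noteq> 0" by simp
    note bd = Re_source_bounds[OF nz]
    \<comment> \<open>Adding 1 makes every term non-negative, so a partial sum over nearby sources
      bounds the whole sum from below, at the cost of the total weight, which is at most 11.\<close>
    define h where "h = (\<lambda>j::int. \<eta> * (Re (source (of_real (of_int j * \<eta>)) p) + 1))"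
    have h0: "h j \<ge> 0" for j
      unfolding h_def using bd(1)[of "of_int j * \<eta>"] \<eta> by (intro mult_nonneg_nonneg) linarith+
    have ReWh: "(\<Sum>j\<in>{-J..J}. h j) - 11 \<le> Re (W p)"
      using len unfolding ReW h_def distrib_left sum.distrib by simp
    have "0 \<le> (\<Sum>j\<in>{-J..J}. h j)" using h0 by (intro sum_nonneg) auto
    then have lower: "- 11 \<le> Re (W p)" using ReWh by linarith
    then show "- 16 \<le> Re (v p)" using vW(1)[OF pK] by linarith
    have "Re (W p) \<le> (\<Sum>j\<in>{-J..J}. \<eta> * (1 / norm (fst p)))"
      unfolding ReW using \<eta> by (intro sum_mono mult_left_mono bd(2)) auto
    also have "\<dots> = (\<Sum>j\<in>{-J..J}. \<eta>) * (1 / norm (fst p))" by (rule sum_distrib_right[symmetric])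
    also have "\<dots> \<le> 16 * (1 / norm (fst p))" using len n by (intro mult_right_mono) auto
    finally show "Re (v p) \<le> 16 / norm (fst p) + 16" using vW(2)[OF pK] by simp
    show "ln (1 / norm (fst p)) / 2 - 16 \<le> Re (v p)"
    proof (cases "norm (fst p) \<le> 1 / 4")
      case False
      then have "1 / norm (fst p) \<le> 4" using n by (simp add: divide_le_eq)
      then have "ln (1 / norm (fst p)) \<le> ln 4" using n by simp
      also have "\<dots> \<le> 4 - 1" by (rule ln_le_minus_one) simp
      finally show ?thesis using lower vW(1)[OF pK] by linarith
    next
      case True
      define \<rho> where "\<rho> = norm (fst p)"
      \<comment> \<open>The \<open>M\<close> sources counted from \<open>j0\<close>, the first at or
        above the height of \<open>p\<close>, have vertical distance at most \<open>1 / 4\<close>.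
        With \<open>\<rho> \<le> 1 / 4\<close> this stays in the range of
        \<open>Re_source_ge\<close>.\<close>
      define M where "M = nat \<lfloor>1 / (4 * \<eta>)\<rfloor>"
      define j0 where "j0 = \<lceil>snd p / \<eta>\<rceil>"
      have M: "real M * \<eta> \<le> 1 / 4" "1 / 4 < (real M + 1) * \<eta>"
      proof -
        have "0 \<le> 1 / (4 * \<eta>)" using \<eta> by simp
        then have "real M \<le> 1 / (4 * \<eta>)" "1 / (4 * \<eta>) < real M + 1" unfolding M_def by linarith+
        then show "real M * \<eta> \<le> 1 / 4" "1 / 4 < (real M + 1) * \<eta>"
          using \<eta> by (simp_all add: field_simps)
      qed
      have j0: "snd p \<le> of_int j0 * \<eta>" "of_int j0 * \<eta> < snd p + \<eta>"
      proof -
        have "snd p / \<eta> \<le> of_int j0" "of_int j0 < snd p / \<eta> + 1" unfolding j0_def by linarith+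
        then show "snd p \<le> of_int j0 * \<eta>" "of_int j0 * \<eta> < snd p + \<eta>"
          using \<eta> by (simp_all add: field_simps)
      qed
      have m: "of_int (j0 + int m) * \<eta> = of_int j0 * \<eta> + real m * \<eta>" for m
        by (simp add: algebra_simps)
      have mM: "(real m + 1) * \<eta> \<le> 1 / 4" if "m < M" for m
      proof -
        have "(real m + 1) * \<eta> \<le> real M * \<eta>" using that \<eta> by (intro mult_right_mono) auto
        then show ?thesis using M by linarith
      qed
      have "(\<Sum>m<M. \<eta> / (\<rho> + (real m + 1) * \<eta>)) / 2 \<le> (\<Sum>m<M. h (j0 + int m))"
        unfolding sum_divide_distrib
      proof (rule sum_mono)
        fix m assume "m \<in> {..<M}"
        then have mm: "(real m + 1) * \<eta> \<le> 1 / 4" using mM by simp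
        have "real m * \<eta> \<ge> 0" using \<eta> by simp
        then have "\<bar>snd p - of_int (j0 + int m) * \<eta>\<bar> \<le> (real m + 1) * \<eta>"
          using j0 \<eta> unfolding m distrib_right mult_1 by linarith
        then have "1 / (2 * (\<rho> + (real m + 1) * \<eta>)) \<le> Re (source (of_real (of_int (j0 + int m) * \<eta>)) p)"
          unfolding \<rho>_def using True mm by (intro Re_source_ge nz) auto
        then have "\<eta> * (1 / (2 * (\<rho> + (real m + 1) * \<eta>))) \<le> h (j0 + int m)"
          unfolding h_def using \<eta> by (intro mult_left_mono) auto
        then show "\<eta> / (\<rho> + (real m + 1) * \<eta>) / 2 \<le> h (j0 + int m)" by (simp add: mult.commute)
      qed
      also have "\<dots> = (\<Sum>j\<in>(\<lambda>m. j0 + int m) ` {..<M}. h j)"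
        by (subst sum.reindex) (auto simp: inj_on_def)
      also have "\<dots> \<le> (\<Sum>j\<in>{-J..J}. h j)"
      proof (rule sum_mono2)
        show "(\<lambda>m. j0 + int m) ` {..<M} \<subseteq> {-J..J}"
        proof (intro image_subsetI)
          fix m assume "m \<in> {..<M}"
          then have mm: "(real m + 1) * \<eta> \<le> 1 / 4" using mM by simp
          have "0 \<le> real m * \<eta>" using \<eta> by simp
          moreover have "real m * \<eta> + \<eta> \<le> 1 / 4" using mm by (simp add: distrib_right)
          moreover have "- 4 \<le> snd p" "snd p \<le> 4" using p by linarith+
          ultimately have "- (real_of_int J * \<eta>) \<le> of_int (j0 + int m) * \<eta>"
            "of_int (j0 + int m) * \<eta> \<le> real_of_int J * \<eta>"
            unfolding m using j0 J \<eta> by linarith+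
          then have "of_int (- J) * \<eta> \<le> of_int (j0 + int m) * \<eta>"
            "of_int (j0 + int m) * \<eta> \<le> of_int J * \<eta>" by simp_all
          then show "j0 + int m \<in> {-J..J}"
            using \<eta> by (simp only: mult_le_cancel_right_pos of_int_le_iff atLeastAtMost_iff)
        qed
      qed (use h0 in auto)
      finally have "(\<Sum>m<M. \<eta> / (\<rho> + (real m + 1) * \<eta>)) / 2 \<le> Re (W p) + 11" using ReWh by linarith
      \<comment> \<open>The finite length of the segment and its spacing cost
        \<open>ln 8 \<le> 7\<close>. Half of 7, the shift 11 and the approximation error 1 add up to
        less than 16.\<close>
      moreover have "ln (1 / \<rho>) - 7 \<le> (\<Sum>m<M. \<eta> / (\<rho> + (real m + 1) * \<eta>))"
      proof -
        have \<rho>: "\<rho> > 0" "\<eta> \<le> \<rho>" using n p by (auto simp: \<rho>_def)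
        have "ln (1 / \<rho>) - 7 \<le> ln (1 / \<rho>) - ln 8" using ln_le_minus_one[of 8] by simp
        also have "\<dots> = ln ((1 / \<rho>) / 8)" using \<rho> ln_div[of "1 / \<rho>" 8] by simp
        also have "(1 / \<rho>) / 8 = (1 / 4) / (2 * \<rho>)" by simp
        also have "ln ((1 / 4) / (2 * \<rho>)) \<le> ln ((\<rho> + (real M + 1) * \<eta>) / (\<rho> + \<eta>))"
        proof (rule ln_mono)
          show "(1 / 4) / (2 * \<rho>) \<le> (\<rho> + (real M + 1) * \<eta>) / (\<rho> + \<eta>)"
            using \<rho> M \<eta> by (intro frac_le) auto
        qed (use \<rho> in auto)
        also have "\<dots> \<le> (\<Sum>m<M. \<eta> / (\<rho> + (real m + 1) * \<eta>))"
          using \<rho> \<eta> by (intro sum_reciprocal_ge_ln) auto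
        finally show ?thesis .
      qed
      ultimately show ?thesis using vW(1)[OF pK] unfolding \<rho>_def by linarith
    qed
  qed
qed

section \<open>A thin region\<close>

lemma waves_cos:
  assumes "a \<in> \<rat>" "b \<in> \<rat>" "c \<in> \<rat>" "a\<^sup>2 + b\<^sup>2 + c\<^sup>2 = 2"
  shows "(\<lambda>p. of_real (cos (a * Re (fst p) + b * Im (fst p) + c * snd p))) \<in> waves"
proof -
  have "(\<lambda>p. (1 / 2) * (cis (a * Re (fst p) + b * Im (fst p) + c * snd p)
      + cis ((- a) * Re (fst p) + (- b) * Im (fst p) + (- c) * snd p))) \<in> waves"
    by (intro waves_scale waves_add waves_cis) (use assms in auto)
  moreover have "(1 / 2) * (cis (a * x + b * y + c * z) + cis ((- a) * x + (- b) * y + (- c) * z))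
      = of_real (cos (a * x + b * y + c * z))" for x y z
  proof -
    have "(- a) * x + (- b) * y + (- c) * z = - (a * x + b * y + c * z)" by simp
    then show ?thesis by (simp only:) (simp add: complex_eq_iff del: minus_add_distrib)
  qed
  ultimately show ?thesis by simp
qed

text \<open>The product formula for cosines gives six frequencies with two entries of absolute value
  1 and one entry 0.\<close>

lemma symmetric_cosine_wave:
  "(\<lambda>p. of_real (cos (Re (fst p)) * cos (Im (fst p)) + cos (Im (fst p)) * cos (snd p)
      + cos (snd p) * cos (Re (fst p)))) \<in> waves"
proof -
  define C where "C a b c = (\<lambda>p. of_real (cos (a * Re (fst p) + b * Im (fst p) + c * snd p)) :: complex)"
    for a b c and p :: "complex \<times> real"
  have C: "C 1 1 0 \<in> waves" "C 1 (-1) 0 \<in> waves" "C 0 1 1 \<in> waves" "C 0 1 (-1) \<in> waves"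
    "C 1 0 1 \<in> waves" "C 1 0 (-1) \<in> waves"
    unfolding C_def by (rule waves_cos; simp)+
  have "(\<lambda>p. (1 / 2) * (C 1 1 0 p + (C 1 (-1) 0 p + (C 0 1 1 p + (C 0 1 (-1) p + (C 1 0 1 p + C 1 0 (-1) p)))))) \<in> waves"
    using C by (intro waves_scale waves_add) simp_all
  moreover have "(1 / 2) * (C 1 1 0 p + (C 1 (-1) 0 p + (C 0 1 1 p + (C 0 1 (-1) p + (C 1 0 1 p + C 1 0 (-1) p)))))
    = of_real (cos (Re (fst p)) * cos (Im (fst p)) + cos (Im (fst p)) * cos (snd p)
      + cos (snd p) * cos (Re (fst p)))" for p
    by (simp add: C_def complex_eq_iff cos_add cos_diff)
  ultimately show ?thesis by (simp only:)
qed

text \<open>Shows that the base function is negative on the faces of the cube, where one cosine is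
  -1. With \<open>s = b + c\<close> between 1 and 2, its value is at most
  \<open>s^2 / 4 - s\<close>, which is largest at \<open>s = 1\<close>.\<close>

lemma symmetric_function_bound:
  fixes a b c :: real
  assumes "a = - 1" "a + b + c \<ge> 0" "b \<le> 1" "c \<le> 1"
  shows "a * b + b * c + c * a \<le> - 3 / 4"
proof -
  have "(b + c - 1) * (b + c - 2) \<le> 0" using assms by (intro mult_nonneg_nonpos) auto
  moreover have "0 \<le> (b - c)\<^sup>2" by simp
  ultimately show ?thesis using assms unfolding assms(1) power2_eq_square by (simp add: algebra_simps)
qed

lemma norm_square_diff_le:
  assumes "\<bar>Re w\<bar> \<le> pi" "\<bar>Im w\<bar> \<le> pi" "\<bar>Re a\<bar> \<le> pi" "\<bar>Im a\<bar> \<le> pi"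
  shows "norm (w - a) \<le> 10"
proof -
  have "\<bar>Re (w - a)\<bar> \<le> 7" "\<bar>Im (w - a)\<bar> \<le> 7" using assms pi_approx by auto
  then have "(Re (w - a))\<^sup>2 \<le> 7\<^sup>2" "(Im (w - a))\<^sup>2 \<le> 7\<^sup>2"
    by (simp_all only: abs_le_square_iff[symmetric] abs_numeral)
  then show ?thesis unfolding cmod_def by (intro real_le_lsqrt) auto
qed

lemma cos_zero_in_period:
  assumes "\<bar>x\<bar> \<le> pi" "cos x = 0"
  shows "x = pi / 2 \<or> x = - (pi / 2)"
proof -
  have "cos \<bar>x\<bar> = cos (pi / 2)" using assms(2) by simp
  then have "\<bar>x\<bar> = pi / 2" using assms(1) cos_inj_pi[of "\<bar>x\<bar>" "pi / 2"] by simp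
  then show ?thesis by linarith
qed

text \<open>The region is cut out of the cube \<open>[-\<pi>, \<pi>]\<^sup>3\<close> by the surface \<open>cos x + cos y + cos z = 0\<close>.  There
  the base function \<open>cos x cos y + cos y cos z + cos z cos x\<close> equals
  \<open>- (cos\<^sup>2 x + cos\<^sup>2 y + cos\<^sup>2 z) / 2\<close>, so it degenerates only at the points \<open>(\<plusminus>\<pi>/2, \<plusminus>\<pi>/2, \<plusminus>\<pi>/2)\<close>;
  tubes are therefore also placed along the lines through these.\<close>

lemma thin_region_exists:
  assumes \<epsilon>: "\<epsilon> > 0"
  obtains u :: "complex \<times> real \<Rightarrow> complex" and D p where
    "u \<in> waves" "closed D" "p \<in> D" "Re (u p) > 0"
    "\<And>q. q \<in> D \<Longrightarrow> \<bar>Re (fst q)\<bar> \<le> pi \<and> \<bar>Im (fst q)\<bar> \<le> pi \<and> \<bar>snd q\<bar> \<le> pi"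
    "\<And>q. q \<in> D \<Longrightarrow> Re (u q) > 0 \<Longrightarrow> q \<in> interior D"
    "\<And>q. q \<in> D \<Longrightarrow> \<exists>w. \<bar>Re w\<bar> \<le> pi \<and> \<bar>Im w\<bar> \<le> pi \<and> dist (fst q) w < \<epsilon> \<and> (w, snd q) \<notin> D"
proof -
  define S where "S = cbox (Complex (- pi) (- pi)) (Complex pi pi)"
  have S: "w \<in> S \<longleftrightarrow> \<bar>Re w\<bar> \<le> pi \<and> \<bar>Im w\<bar> \<le> pi" for w
    unfolding S_def by (auto simp: in_cbox_complex_iff)
  define U where "U q = cos (Re (fst q)) * cos (Im (fst q)) + cos (Im (fst q)) * cos (snd q)
      + cos (snd q) * cos (Re (fst q))" for q :: "complex \<times> real"
  \<comment> \<open>The net provides the holes: every point of the square is within \<epsilon> of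
    the axis of a tube.\<close>
  obtain A0 where A0: "A0 \<subseteq> S" "finite A0" "S \<subseteq> (\<Union>a\<in>A0. ball a \<epsilon>)"
  proof (rule compactE_image[of S S "\<lambda>a. ball a \<epsilon>"])
    show "compact S" by (simp add: S_def compact_cbox)
  qed (use \<epsilon> in auto)
  define B where "B = {Complex (pi / 2) (pi / 2), Complex (pi / 2) (- (pi / 2)),
    Complex (- (pi / 2)) (pi / 2), Complex (- (pi / 2)) (- (pi / 2))}"
  define A where "A = A0 \<union> B"
  have fA: "finite A" using A0 by (simp add: A_def B_def)
  have AS: "a \<in> S" if "a \<in> A" for a
    using that A0 pi_ge_zero unfolding A_def B_def by (auto simp: S)
  define N where "N = real (card A)"
  have N: "N \<ge> 1"
  proof -
    have "A \<noteq> {}" by (simp add: A_def B_def)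
    then have "card A \<ge> 1" using fA by (simp add: Suc_le_eq card_gt_0_iff)
    then show ?thesis by (simp add: N_def)
  qed
  \<comment> \<open>The base point has to avoid the tubes, and the origin may be the centre of one;
    only finitely many points of the unit segment are lost.\<close>
  obtain s :: real where s: "0 < s" "s < 1" "of_real s \<notin> A"
  proof -
    have "infinite ((of_real :: real \<Rightarrow> complex) ` {0<..<1})"
      by (subst finite_image_iff) (auto simp: inj_on_def infinite_Ioo)
    then have "\<not> (of_real :: real \<Rightarrow> complex) ` {0<..<1} \<subseteq> A" using fA finite_subset by blast
    then obtain x where "x \<in> {0<..<1}" "of_real x \<notin> A" by blast
    then show thesis using that by auto
  qed
  obtain d where d: "d > 0" "\<And>a. a \<in> A \<Longrightarrow> d \<le> dist (of_real s) a"
    using finite_set_avoid[OF fA, of "of_real s"] s(3) by metis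
  \<comment> \<open>Chosen so that \<open>X / 2 - 16 = 16 * N\<close>: within distance
    \<open>s1\<close> of an axis, but outside its tube, one tube solution offsets the lower bounds
    \<open>- 16\<close> of all \<open>N\<close> of them.\<close>
  define X where "X = 32 * N + 32"
  define s1 where "s1 = exp (- X)"
  have s1: "s1 > 0" "s1 \<le> 1 / 8"
  proof -
    have "8 \<le> 1 + X" using N by (simp add: X_def)
    also have "\<dots> \<le> exp X" by (rule exp_ge_add_one_self)
    finally have "8 * s1 \<le> exp X * s1" by (intro mult_right_mono) (auto simp: s1_def)
    then show "s1 \<le> 1 / 8" by (simp add: s1_def exp_minus)
  qed (simp add: s1_def)
  define T where "T = S - (\<Union>b\<in>B. ball b s1)"
  \<comment> \<open>In the square the two cosines vanish together only on \<open>B\<close>, so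
    compactness of \<open>T\<close> gives a positive minimum.\<close>
  obtain m where m: "m > 0" "\<And>w. w \<in> T \<Longrightarrow> m \<le> (cos (Re w))\<^sup>2 + (cos (Im w))\<^sup>2"
  proof (cases "T = {}")
    case False
    have "compact T" unfolding T_def by (intro compact_diff open_UN ballI open_ball) (simp add: S_def compact_cbox)
    moreover have "continuous_on T (\<lambda>w. (cos (Re w))\<^sup>2 + (cos (Im w))\<^sup>2)" by (intro continuous_intros)
    ultimately obtain w where w: "w \<in> T" "\<And>v. v \<in> T \<Longrightarrow> (cos (Re w))\<^sup>2 + (cos (Im w))\<^sup>2 \<le> (cos (Re v))\<^sup>2 + (cos (Im v))\<^sup>2"
      using continuous_attains_inf[of T "\<lambda>w. (cos (Re w))\<^sup>2 + (cos (Im w))\<^sup>2"] False by blast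
    have "(cos (Re w))\<^sup>2 + (cos (Im w))\<^sup>2 \<noteq> 0"
    proof
      assume "(cos (Re w))\<^sup>2 + (cos (Im w))\<^sup>2 = 0"
      then have "cos (Re w) = 0" "cos (Im w) = 0" by (simp_all add: sum_power2_eq_zero_iff)
      moreover have "\<bar>Re w\<bar> \<le> pi" "\<bar>Im w\<bar> \<le> pi" using w(1) S by (auto simp: T_def)
      ultimately have "w \<in> B"
        using cos_zero_in_period[of "Re w"] cos_zero_in_period[of "Im w"]
        unfolding B_def by (auto simp: complex_eq_iff)
      then show False using w(1) s1 by (auto simp: T_def)
    qed
    then have "(cos (Re w))\<^sup>2 + (cos (Im w))\<^sup>2 > 0"
      using sum_power2_ge_zero[of "cos (Re w)" "cos (Im w)"] by linarith
    then show thesis using that w(2) by blast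
  qed (use that[of 1] in auto)
  \<comment> \<open>The denominator bounds the sum of the tube solutions at the base point, where
    the correction then costs at most \<open>1 / 2\<close> of \<open>U p \<ge> 2\<close>. It also
    dominates \<open>16 * N\<close>, which limits what negative values can add anywhere in
    \<open>D\<close>.\<close>
  define \<kappa> where "\<kappa> = min (m / 2) (1 / 2) / (N * (16 / d + 16))"
  have den: "N * (16 / d + 16) > 0" using N d by (intro mult_pos_pos add_pos_pos) auto
  have \<kappa>: "\<kappa> > 0" unfolding \<kappa>_def using m den by (intro divide_pos_pos) auto
  have \<kappa>_up: "\<kappa> * (N * (16 / d + 16)) \<le> 1 / 2" "\<kappa> * (N * (16 / d + 16)) \<le> m / 2"
    unfolding \<kappa>_def using den by auto
  have "\<kappa> * (N * 16) \<le> \<kappa> * (N * (16 / d + 16))" using \<kappa> N d by (intro mult_left_mono) auto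
  then have \<kappa>_lo: "\<kappa> * (16 * N) \<le> 1 / 2" "\<kappa> * (16 * N) \<le> m / 2"
    using \<kappa>_up unfolding mult.commute[of 16 N] by linarith+
  \<comment> \<open>On a tube wall the correction \<open>\<kappa> * Y = 4\<close> has to beat
    \<open>U q \<le> 3\<close> plus the contribution \<open>1 / 2\<close> of the other
    tubes.\<close>
  define Y where "Y = 4 / \<kappa>"
  have Y: "Y > 0" using \<kappa> by (simp add: Y_def)
  \<comment> \<open>The term \<open>2 * Y + 32\<close> raises
    \<open>ln (1 / \<eta>) / 2 - 16\<close> to at least \<open>Y\<close>, the term \<open>X\<close>
    gives \<open>\<eta> \<le> s1\<close>, and \<open>d\<close> keeps the base point in
    \<open>D\<close>.\<close>
  define \<eta> where "\<eta> = min d (exp (- (X + (2 * Y + 32))))"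
  have \<eta>0: "0 < \<eta>" using d by (simp add: \<eta>_def)
  have \<eta>d: "\<eta> \<le> d" by (simp add: \<eta>_def)
  have \<eta>e: "\<eta> \<le> exp (- (X + (2 * Y + 32)))" by (simp add: \<eta>_def)
  also have "\<dots> \<le> s1" unfolding s1_def exp_le_cancel_iff neg_le_iff_le using Y by simp
  finally have \<eta>s: "\<eta> \<le> s1" .
  have "ln \<eta> \<le> ln (exp (- (X + (2 * Y + 32))))"
    using \<eta>e \<eta>0 by (subst ln_le_cancel_iff) auto
  then have ln\<eta>: "(2 * Y + 32) \<le> ln (1 / \<eta>)" using \<eta>0 N by (simp add: ln_div X_def)
  have \<eta>8: "\<eta> \<le> 1 / 8" using \<eta>s s1 by linarith
  obtain v where v: "v \<in> waves"
    "\<And>p. \<lbrakk>\<eta> \<le> norm (fst p); norm (fst p) \<le> 10; \<bar>snd p\<bar> \<le> 4\<rbrakk> \<Longrightarrow> - 16 \<le> Re (v p)"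
    "\<And>p. \<lbrakk>\<eta> \<le> norm (fst p); norm (fst p) \<le> 10; \<bar>snd p\<bar> \<le> 4\<rbrakk> \<Longrightarrow> Re (v p) \<le> 16 / norm (fst p) + 16"
    "\<And>p. \<lbrakk>\<eta> \<le> norm (fst p); norm (fst p) \<le> 10; \<bar>snd p\<bar> \<le> 4\<rbrakk> \<Longrightarrow> ln (1 / norm (fst p)) / 2 - 16 \<le> Re (v p)"
    by (rule tube_wave_exists[OF \<eta>0 \<eta>8], rule that)
  define V where "V a q = v (fst q - a, snd q)" for a q
  define u where "u q = of_real (U q) + (of_real (- \<kappa>)) * (\<Sum>a\<in>A. V a q)" for q
  define D where "D = {q. \<bar>Re (fst q)\<bar> \<le> pi} \<inter> {q. \<bar>Im (fst q)\<bar> \<le> pi} \<inter> {q. \<bar>snd q\<bar> \<le> pi}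
    \<inter> {q. 0 \<le> cos (Re (fst q)) + cos (Im (fst q)) + cos (snd q)}
    \<inter> (\<Inter>a\<in>A. {q. \<eta> \<le> norm (fst q - a)})"
  define D' where "D' = {q. \<bar>Re (fst q)\<bar> < pi} \<inter> {q. \<bar>Im (fst q)\<bar> < pi} \<inter> {q. \<bar>snd q\<bar> < pi}
    \<inter> {q. 0 < cos (Re (fst q)) + cos (Im (fst q)) + cos (snd q)}
    \<inter> (\<Inter>a\<in>A. {q. \<eta> < norm (fst q - a)})"
  have Reu: "Re (u q) = U q - \<kappa> * (\<Sum>a\<in>A. Re (V a q))" for q
    by (simp add: u_def)
  have uw: "u \<in> waves"
    unfolding u_def V_def U_def
    by (intro waves_add waves_scale waves_sum waves_translate v(1) symmetric_cosine_wave)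
  have cD: "closed D"
    unfolding D_def by (intro closed_Int closed_INT ballI closed_Collect_le continuous_intros)
  have oD': "open D'"
    unfolding D'_def by (intro open_Int open_INT fA ballI open_Collect_less continuous_intros)
  have "D' \<subseteq> D" unfolding D'_def D_def by (auto intro: less_imp_le)
  then have intD: "D' \<subseteq> interior D" using oD' by (rule interior_maximal)
  have Dq: "\<eta> \<le> norm (fst q - a)" "norm (fst q - a) \<le> 10" "\<bar>snd q\<bar> \<le> 4" if "q \<in> D" "a \<in> A" for q a
    using that norm_square_diff_le[of "fst q" a] AS[OF that(2)] pi_less_4 unfolding D_def S by auto
  have Vlo: "- 16 \<le> Re (V a q)" if "q \<in> D" "a \<in> A" for q a
    using v(2)[of "(fst q - a, snd q)"] Dq[OF that] by (simp add: V_def)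
  have Vln: "ln (1 / norm (fst q - a)) / 2 - 16 \<le> Re (V a q)" if "q \<in> D" "a \<in> A" for q a
    using v(4)[of "(fst q - a, snd q)"] Dq[OF that] by (simp add: V_def)
  have Vup: "Re (V a q) \<le> 16 / norm (fst q - a) + 16" if "q \<in> D" "a \<in> A" for q a
    using v(3)[of "(fst q - a, snd q)"] Dq[OF that] by (simp add: V_def)
  have sum_lo: "- (16 * N) \<le> (\<Sum>a\<in>A. Re (V a q))" if "q \<in> D" for q
  proof -
    have "(\<Sum>a\<in>A. - 16) \<le> (\<Sum>a\<in>A. Re (V a q))" using Vlo that by (intro sum_mono) auto
    then show ?thesis by (simp add: N_def mult.commute)
  qed
  have sum_lo1: "Re (V a q) - 16 * N \<le> (\<Sum>a\<in>A. Re (V a q))" if q: "q \<in> D" and a: "a \<in> A" for q a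
  proof -
    have "(\<Sum>a\<in>A - {a}. - 16) \<le> (\<Sum>a\<in>A - {a}. Re (V a q))" using Vlo q by (intro sum_mono) auto
    moreover have "real (card (A - {a})) \<le> N" unfolding N_def using fA by (simp add: card_mono)
    ultimately show ?thesis using fA a by (simp add: sum.remove)
  qed
  have neg1: "Re (u q) \<le> U q + \<kappa> * (16 * N)" if "q \<in> D" for q
  proof -
    have "\<kappa> * - (16 * N) \<le> \<kappa> * (\<Sum>a\<in>A. Re (V a q))" using sum_lo[OF that] \<kappa> by (intro mult_left_mono) auto
    then show ?thesis unfolding Reu by simp
  qed
  have neg2: "Re (u q) \<le> U q + \<kappa> * (16 * N) - \<kappa> * Re (V a q)" if "q \<in> D" "a \<in> A" for q a
  proof -
    have "\<kappa> * (Re (V a q) - 16 * N) \<le> \<kappa> * (\<Sum>a\<in>A. Re (V a q))"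
      using sum_lo1[OF that] \<kappa> by (intro mult_left_mono) auto
    then show ?thesis unfolding Reu by (simp add: algebra_simps)
  qed
  \<comment> \<open>Positivity makes each inequality defining \<open>D\<close> strict: on the faces
    of the cube, on the tube walls and on the surface where the cosines sum to 0.\<close>
  have DD': "q \<in> D'" if q: "q \<in> D" and pos: "Re (u q) > 0" for q
  proof -
    let ?a = "cos (Re (fst q))" and ?b = "cos (Im (fst q))" and ?c = "cos (snd q)"
    have abc: "0 \<le> ?a + ?b + ?c" using q by (simp add: D_def)
    have le1: "?a \<le> 1" "?b \<le> 1" "?c \<le> 1" by auto
    have "U q > - 3 / 4" using neg1[OF q] pos \<kappa>_lo by linarith
    then have ne: "?a \<noteq> - 1" "?b \<noteq> - 1" "?c \<noteq> - 1"
      using symmetric_function_bound[of ?a ?b ?c] symmetric_function_bound[of ?b ?c ?a]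
        symmetric_function_bound[of ?c ?a ?b] abc le1 unfolding U_def by (auto simp: algebra_simps)
    have ltpi: "\<bar>x\<bar> < pi" if "\<bar>x\<bar> \<le> pi" "cos x \<noteq> - 1" for x :: real
    proof (rule ccontr)
      assume "\<not> \<bar>x\<bar> < pi"
      then have "\<bar>x\<bar> = pi" using that by simp
      then have "cos \<bar>x\<bar> = - 1" by simp
      then show False using that by simp
    qed
    have tube: "\<eta> < norm (fst q - a)" if a: "a \<in> A" for a
    proof (rule ccontr)
      assume "\<not> \<eta> < norm (fst q - a)"
      then have eq: "norm (fst q - a) = \<eta>" using Dq[OF q a] by simp
      have "Y \<le> Re (V a q)" using Vln[OF q a] ln\<eta> unfolding eq by linarith
      then have "4 \<le> \<kappa> * Re (V a q)" using \<kappa> by (simp add: Y_def field_simps)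
      moreover have "U q \<le> 3"
      proof -
        have "x * y \<le> 1" if "\<bar>x\<bar> \<le> 1" "\<bar>y\<bar> \<le> 1" for x y :: real
          using that mult_mono[of "\<bar>x\<bar>" 1 "\<bar>y\<bar>" 1] abs_ge_self[of "x * y"] by (simp add: abs_mult)
        then have "?a * ?b \<le> 1" "?b * ?c \<le> 1" "?c * ?a \<le> 1" by auto
        then show ?thesis unfolding U_def by linarith
      qed
      ultimately show False using neg2[OF q a] pos \<kappa>_lo by linarith
    qed
    have "?a + ?b + ?c \<noteq> 0"
    proof
      assume 0: "?a + ?b + ?c = 0"
      have "2 * U q = (?a + ?b + ?c)\<^sup>2 - (?a\<^sup>2 + ?b\<^sup>2 + ?c\<^sup>2)"
        unfolding U_def by (simp add: power2_eq_square algebra_simps)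
      then have Uq: "2 * U q = - ?a\<^sup>2 - ?b\<^sup>2 - ?c\<^sup>2" unfolding 0 by simp
      \<comment> \<open>Over \<open>T\<close> the value \<open>U q \<le> - m / 2\<close> absorbs
        whatever negative tube values add. Near a point of \<open>B\<close> only
        \<open>U q \<le> 0\<close> is available, but the tube there contributes at least
        \<open>16 * N\<close> and cancels them.\<close>
      show False
      proof (cases "fst q \<in> T")
        case True
        then have "m \<le> ?a\<^sup>2 + ?b\<^sup>2" by (rule m(2))
        then have "2 * U q \<le> - m" using Uq zero_le_power2[of ?c] by linarith
        then show False using neg1[OF q] \<kappa>_lo pos by linarith
      next
        case False
        moreover have "fst q \<in> S" using q by (simp add: D_def S)
        ultimately obtain b where b: "b \<in> B" "norm (fst q - b) < s1"
          unfolding T_def by (auto simp: dist_norm norm_minus_commute)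
        have bA: "b \<in> A" using b by (simp add: A_def)
        have n0: "0 < norm (fst q - b)" using Dq(1)[OF q bA] \<eta>0 by linarith
        have "ln (norm (fst q - b)) \<le> ln s1" using b(2) n0 by (intro ln_mono) auto
        then have "X \<le> ln (1 / norm (fst q - b))" using n0 by (simp add: s1_def ln_div)
        then have "16 * N \<le> Re (V b q)" using Vln[OF q bA] by (simp add: X_def)
        then have "\<kappa> * (16 * N) \<le> \<kappa> * Re (V b q)" using \<kappa> by simp
        moreover have "U q \<le> 0"
          using Uq zero_le_power2[of ?a] zero_le_power2[of ?b] zero_le_power2[of ?c] by linarith
        ultimately show False using neg2[OF q bA] pos by linarith
      qed
    qed
    then have "0 < ?a + ?b + ?c" using abc by linarith
    then show ?thesis
      using q tube ltpi[OF _ ne(1)] ltpi[OF _ ne(2)] ltpi[OF _ ne(3)] unfolding D_def D'_def by blast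
  qed
  define p :: "complex \<times> real" where "p = (of_real s, 0)"
  have cs: "1 / 2 \<le> cos s"
  proof -
    have "cos (pi / 3) \<le> cos s" using s pi_gt3 by (intro cos_monotone_0_pi_le) auto
    then show ?thesis by (simp add: cos_60)
  qed
  have pD: "p \<in> D"
    using s cs pi_gt3 d \<eta>d unfolding D_def p_def by (auto simp: dist_norm intro: order_trans)
  have "(\<Sum>a\<in>A. Re (V a p)) \<le> (\<Sum>a\<in>A. 16 / d + 16)"
  proof (rule sum_mono)
    fix a assume a: "a \<in> A"
    have "16 / norm (fst p - a) \<le> 16 / d"
      using d(2)[OF a] d(1) unfolding p_def by (intro divide_left_mono) (auto simp: dist_norm intro!: mult_pos_pos)
    then show "Re (V a p) \<le> 16 / d + 16" using Vup[OF pD a] by linarith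
  qed
  also have "\<dots> = N * (16 / d + 16)" by (simp add: N_def)
  finally have "\<kappa> * (\<Sum>a\<in>A. Re (V a p)) \<le> \<kappa> * (N * (16 / d + 16))" using \<kappa> by (intro mult_left_mono) auto
  then have "\<kappa> * (\<Sum>a\<in>A. Re (V a p)) \<le> 1 / 2" using \<kappa>_up by linarith
  moreover have "U p \<ge> 2" using cs by (simp add: U_def p_def)
  ultimately have up: "Re (u p) > 0" unfolding Reu by linarith
  show thesis
  proof (rule that[OF uw cD pD up])
    show "\<bar>Re (fst q)\<bar> \<le> pi \<and> \<bar>Im (fst q)\<bar> \<le> pi \<and> \<bar>snd q\<bar> \<le> pi" if "q \<in> D" for q
      using that by (simp add: D_def)
    show "q \<in> interior D" if "q \<in> D" "Re (u q) > 0" for q using DD'[OF that] intD by blast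
    show "\<exists>w. \<bar>Re w\<bar> \<le> pi \<and> \<bar>Im w\<bar> \<le> pi \<and> dist (fst q) w < \<epsilon> \<and> (w, snd q) \<notin> D" if "q \<in> D" for q
    proof -
      have "fst q \<in> S" using that by (simp add: D_def S)
      then obtain a where a: "a \<in> A0" "dist (fst q) a < \<epsilon>" using A0(3) by (auto simp: dist_commute)
      then have "a \<in> A" "a \<in> S" using A0(1) by (auto simp: A_def)
      moreover have "(a, snd q) \<notin> D" using \<open>a \<in> A\<close> \<eta>0 by (auto simp: D_def intro!: bexI[of _ a])
      ultimately show ?thesis using a S by blast
    qed
  qed
qed

section \<open>Eigenfunctions and nodal domains on the torus\<close>

text \<open>This class of trigonometric sums is closed under partial derivatives, so smoothness of
  every order and the eigenvalue equation both follow by induction.\<close>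

inductive_set helmholtz :: "real \<Rightarrow> (real ^ 'n::finite \<Rightarrow> real) set" for L where
  zero: "(\<lambda>x. 0) \<in> helmholtz L"
| step: "f \<in> helmholtz L \<Longrightarrow> \<nu> \<bullet> \<nu> = L
    \<Longrightarrow> (\<lambda>x. f x + \<alpha> * cos (\<nu> \<bullet> x) + \<beta> * sin (\<nu> \<bullet> x)) \<in> helmholtz L"

lemma helmholtz_differentiable: "f \<in> helmholtz L \<Longrightarrow> f differentiable (at x)"
proof (induction f rule: helmholtz.induct)
  case (step f \<nu> \<alpha> \<beta>)
  have "((\<lambda>x. \<alpha> * cos (\<nu> \<bullet> x)) has_derivative (\<lambda>h. \<alpha> * (- sin (\<nu> \<bullet> x) * (\<nu> \<bullet> h)))) (at x)"
    "((\<lambda>x. \<beta> * sin (\<nu> \<bullet> x)) has_derivative (\<lambda>h. \<beta> * (cos (\<nu> \<bullet> x) * (\<nu> \<bullet> h)))) (at x)"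
    by (auto intro!: derivative_eq_intros simp: algebra_simps)
  then have "(\<lambda>x. \<alpha> * cos (\<nu> \<bullet> x)) differentiable (at x)" "(\<lambda>x. \<beta> * sin (\<nu> \<bullet> x)) differentiable (at x)"
    unfolding differentiable_def by blast+
  then show ?case using step.IH by (intro differentiable_add)
qed simp

lemma helmholtz_continuous: "f \<in> helmholtz L \<Longrightarrow> continuous_on UNIV f"
  using helmholtz_differentiable
  by (intro continuous_at_imp_continuous_on ballI differentiable_imp_continuous_within)

lemma has_partial_deriv_helmholtz:
  fixes i :: "'n::finite"
  assumes "f \<in> helmholtz L"
  shows "((\<lambda>t. f (x + t *\<^sub>R axis i 1)) has_real_derivative partial_deriv i f x) (at 0)"
proof -
  have "f differentiable (at (x + 0 *\<^sub>R axis i 1))" using helmholtz_differentiable[OF assms] .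
  moreover have "(\<lambda>t::real. x + t *\<^sub>R axis i 1) differentiable (at 0)"
    by (intro derivative_intros)
  ultimately have "(\<lambda>t. f (x + t *\<^sub>R axis i 1)) differentiable (at (0::real))"
    using differentiable_compose[of f "\<lambda>t. x + t *\<^sub>R axis i 1" 0 UNIV] by simp
  then show ?thesis
    unfolding partial_deriv_def using DERIV_deriv_iff_real_differentiable by blast
qed

lemma partial_deriv_step:
  fixes i :: "'n::finite"
  assumes "f \<in> helmholtz L"
  shows "partial_deriv i (\<lambda>x. f x + \<alpha> * cos (\<nu> \<bullet> x) + \<beta> * sin (\<nu> \<bullet> x))
    = (\<lambda>x. partial_deriv i f x + (\<beta> * \<nu> $ i) * cos (\<nu> \<bullet> x) + (- \<alpha> * \<nu> $ i) * sin (\<nu> \<bullet> x))"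
proof
  fix x
  have "((\<lambda>t. f (x + t *\<^sub>R axis i 1) + \<alpha> * cos (\<nu> \<bullet> (x + t *\<^sub>R axis i 1)) + \<beta> * sin (\<nu> \<bullet> (x + t *\<^sub>R axis i 1)))
    has_real_derivative
    partial_deriv i f x + (\<beta> * \<nu> $ i) * cos (\<nu> \<bullet> x) + (- \<alpha> * \<nu> $ i) * sin (\<nu> \<bullet> x)) (at 0)"
    unfolding inner_add_right inner_scaleR_right inner_axis
    by (rule derivative_eq_intros has_partial_deriv_helmholtz[OF assms] refl)+ (simp add: inner_axis)
  then show "partial_deriv i (\<lambda>x. f x + \<alpha> * cos (\<nu> \<bullet> x) + \<beta> * sin (\<nu> \<bullet> x)) x
    = partial_deriv i f x + (\<beta> * \<nu> $ i) * cos (\<nu> \<bullet> x) + (- \<alpha> * \<nu> $ i) * sin (\<nu> \<bullet> x)"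
    by (subst partial_deriv_def) (rule DERIV_imp_deriv)
qed

lemma partial_deriv_zero: "partial_deriv i (\<lambda>x. 0) = (\<lambda>x. 0)"
  by (simp add: partial_deriv_def fun_eq_iff)

lemma partial_deriv_helmholtz: "f \<in> helmholtz L \<Longrightarrow> partial_deriv i f \<in> helmholtz L"
proof (induction f rule: helmholtz.induct)
  case (step f \<nu> \<alpha> \<beta>)
  show ?case unfolding partial_deriv_step[OF step.hyps(1)] by (rule helmholtz.step[OF step.IH step.hyps(2)])
qed (simp add: partial_deriv_zero helmholtz.zero)

lemma Ck_helmholtz: "f \<in> helmholtz L \<Longrightarrow> Ck k f"
proof (induction k arbitrary: f)
  case 0
  then show ?case by (simp add: helmholtz_continuous)
next
  case (Suc k)
  then show ?case
    by (auto simp: differentiable_on_def helmholtz_differentiable partial_deriv_helmholtz)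
qed

lemma laplacian_helmholtz:
  "f \<in> helmholtz L \<Longrightarrow> (\<Sum>i\<in>UNIV. partial_deriv i (partial_deriv i f) x) = - L * f x"
proof (induction f rule: helmholtz.induct)
  case (step f \<nu> \<alpha> \<beta>)
  have L: "(\<Sum>i\<in>UNIV. \<nu> $ i * \<nu> $ i) = L" using step.hyps(2) by (simp add: inner_vec_def)
  have "(\<Sum>i\<in>UNIV. partial_deriv i (partial_deriv i (\<lambda>x. f x + \<alpha> * cos (\<nu> \<bullet> x) + \<beta> * sin (\<nu> \<bullet> x))) x)
    = (\<Sum>i\<in>UNIV. partial_deriv i (partial_deriv i f) x - (\<nu> $ i * \<nu> $ i) * (\<alpha> * cos (\<nu> \<bullet> x) + \<beta> * sin (\<nu> \<bullet> x)))"
    unfolding partial_deriv_step[OF step.hyps(1)] partial_deriv_step[OF partial_deriv_helmholtz[OF step.hyps(1)]]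
    by (simp add: algebra_simps)
  also have "\<dots> = - L * (f x + \<alpha> * cos (\<nu> \<bullet> x) + \<beta> * sin (\<nu> \<bullet> x))"
    unfolding sum_subtractf step.IH sum_distrib_right[symmetric] L by (simp add: algebra_simps)
  finally show ?case .
qed (simp add: partial_deriv_zero)

lemma torus_rel_rep: "torus_rel (torus_rep (torus_proj x)) x"
  by (metis torus_proj_eq_iff Quotient3_abs_rep Quotient3_torus)

lemma torus_eigenfunctionI:
  assumes f: "f \<in> helmholtz L" and per: "\<And>x y. torus_rel x y \<Longrightarrow> f x = f y" and "f x \<noteq> 0"
  shows "torus_eigenfunction L (\<lambda>p. f (torus_rep p))"
proof -
  have comp: "(\<lambda>p. f (torus_rep p)) \<circ> torus_proj = f"
    using per[OF torus_rel_rep] by auto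
  show ?thesis
    unfolding torus_eigenfunction_def torus_smooth_def torus_laplacian_def comp
  proof (intro conjI allI)
    show "Ck k f" for k by (rule Ck_helmholtz[OF f])
    show "\<exists>p. f (torus_rep p) \<noteq> 0"
      using per[OF torus_rel_rep, of x] assms(3) by (intro exI[of _ "torus_proj x"]) simp
    show "- (\<Sum>i\<in>UNIV. partial_deriv i (partial_deriv i f) (torus_rep p)) = L * f (torus_rep p)" for p
      by (simp add: laplacian_helmholtz[OF f])
  qed
qed

section \<open>Periodicity after rescaling\<close>

lemma rational_clear_denominator:
  assumes "r \<in> \<rat>"
  obtains n :: nat where "n > 0" "\<And>M. n dvd M \<Longrightarrow> real M * r \<in> \<int>"
proof -
  obtain a b :: int where ab: "b > 0" "r = of_int a / of_int b" using assms by (rule Rats_cases')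
  show thesis
  proof (rule that[of "nat b"])
    show "real M * r \<in> \<int>" if "nat b dvd M" for M
    proof -
      obtain k where "M = nat b * k" using \<open>nat b dvd M\<close> by (rule dvdE)
      then have "real M * r = of_int (int k * a)" using ab by simp
      then show ?thesis by (metis Ints_of_int)
    qed
  qed (use ab in simp)
qed

definition slice :: "'n \<Rightarrow> 'n \<Rightarrow> 'n \<Rightarrow> nat \<Rightarrow> real ^ 'n::finite \<Rightarrow> complex \<times> real" where
  "slice i j l M x = (Complex (M * x $ i) (M * x $ j), M * x $ l)"

text \<open>A product of denominators makes the finitely many frequencies integral. Allowing all
  multiples \<open>M\<close> of it leaves the scale free to be taken large later.\<close>

lemma waves_slice:
  fixes i j l :: "'n::finite"
  assumes u: "u \<in> waves" and ijl: "i \<noteq> j" "i \<noteq> l" "j \<noteq> l"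
  obtains N :: nat where "N > 0"
    "\<And>M. N dvd M \<Longrightarrow> (\<lambda>x. Re (u (slice i j l M x))) \<in> helmholtz (2 * (real M)\<^sup>2)"
    "\<And>M x y. N dvd M \<Longrightarrow> torus_rel x y \<Longrightarrow> u (slice i j l M x) = u (slice i j l M y)"
proof -
  have "\<exists>N>0. \<forall>M. N dvd M \<longrightarrow> (\<lambda>x. Re (u (slice i j l M x))) \<in> helmholtz (2 * (real M)\<^sup>2)
    \<and> (\<forall>x y. torus_rel x y \<longrightarrow> u (slice i j l M x) = u (slice i j l M y))"
    using u
  proof (induction u rule: waves.induct)
    case zero
    show ?case by (intro exI[of _ 1]) (simp add: helmholtz.zero)
  next
    case (step f a b c C)
    obtain N where N: "N > 0" and NN: "\<forall>M. N dvd M \<longrightarrow>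
        (\<lambda>x. Re (f (slice i j l M x))) \<in> helmholtz (2 * (real M)\<^sup>2)
        \<and> (\<forall>x y. torus_rel x y \<longrightarrow> f (slice i j l M x) = f (slice i j l M y))"
      using step.IH by (elim exE conjE)
    note Nh = NN[rule_format, THEN conjunct1] and Np = NN[rule_format, THEN conjunct2, rule_format]
    obtain n1 where n1: "n1 > 0" "\<And>M. n1 dvd M \<Longrightarrow> real M * a \<in> \<int>"
      by (rule rational_clear_denominator[OF step.hyps(2)], rule that)
    obtain n2 where n2: "n2 > 0" "\<And>M. n2 dvd M \<Longrightarrow> real M * b \<in> \<int>"
      by (rule rational_clear_denominator[OF step.hyps(3)], rule that)
    obtain n3 where n3: "n3 > 0" "\<And>M. n3 dvd M \<Longrightarrow> real M * c \<in> \<int>"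
      by (rule rational_clear_denominator[OF step.hyps(4)], rule that)
    show ?case
    proof (intro exI[of _ "N * n1 * n2 * n3"] conjI allI impI)
      show "0 < N * n1 * n2 * n3" using N n1 n2 n3 by simp
      fix M assume "N * n1 * n2 * n3 dvd M"
      then have M: "N dvd M" "n1 dvd M" "n2 dvd M" "n3 dvd M"
        by (auto dest: dvd_mult_left dvd_mult_right)
      define \<nu> :: "real ^ 'n" where "\<nu> = axis i (M * a) + axis j (M * b) + axis l (M * c)"
      have \<nu>x: "\<nu> \<bullet> x = M * a * x $ i + M * b * x $ j + M * c * x $ l" for x
        by (simp add: \<nu>_def inner_add_left inner_axis')
      have phase: "a * Re (fst (slice i j l M x)) + b * Im (fst (slice i j l M x)) + c * snd (slice i j l M x) = \<nu> \<bullet> x" for x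
        unfolding \<nu>x slice_def by (simp add: mult_ac)
      have "\<nu> \<bullet> \<nu> = (real M)\<^sup>2 * (a\<^sup>2 + b\<^sup>2 + c\<^sup>2)"
        unfolding \<nu>x using ijl by (simp add: \<nu>_def axis_def power2_eq_square algebra_simps)
      then have \<nu>\<nu>: "\<nu> \<bullet> \<nu> = 2 * (real M)\<^sup>2" using step.hyps(5) by simp
      show "(\<lambda>x. Re (f (slice i j l M x) + C * cis (a * Re (fst (slice i j l M x)) + b * Im (fst (slice i j l M x))
          + c * snd (slice i j l M x)))) \<in> helmholtz (2 * (real M)\<^sup>2)"
        using helmholtz.step[OF Nh[OF M(1)] \<nu>\<nu>, of "Re C" "- Im C"] unfolding phase by (simp add: add_diff_eq)
      fix x y :: "real ^ 'n" assume xy: "torus_rel x y"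
      obtain p q r :: int where pqr: "x $ i - y $ i = 2 * pi * p" "x $ j - y $ j = 2 * pi * q" "x $ l - y $ l = 2 * pi * r"
        using xy unfolding torus_rel_def by metis
      have "\<nu> \<bullet> x - \<nu> \<bullet> y = M * a * (x $ i - y $ i) + M * b * (x $ j - y $ j) + M * c * (x $ l - y $ l)"
        unfolding \<nu>x by (simp add: algebra_simps)
      also have "\<dots> = 2 * pi * (M * a * p + M * b * q + M * c * r)" unfolding pqr by (simp add: algebra_simps)
      finally have "\<nu> \<bullet> x = \<nu> \<bullet> y + 2 * pi * (M * a * p + M * b * q + M * c * r)" by simp
      moreover have "M * a * p + M * b * q + M * c * r \<in> \<int>"
        by (intro Ints_add; rule Ints_mult) (use M n1(2) n2(2) n3(2) in auto)
      ultimately have "cis (\<nu> \<bullet> x) = cis (\<nu> \<bullet> y)"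
        by (simp only: cis_mult[symmetric] cis_multiple_2pi mult_1_right)
      then show "f (slice i j l M x) + C * cis (a * Re (fst (slice i j l M x)) + b * Im (fst (slice i j l M x))
          + c * snd (slice i j l M x))
        = f (slice i j l M y) + C * cis (a * Re (fst (slice i j l M y)) + b * Im (fst (slice i j l M y))
          + c * snd (slice i j l M y))"
        unfolding phase Np[OF M(1) xy] by simp
    qed
  qed
  then obtain N where "N > 0" and N: "\<forall>M. N dvd M \<longrightarrow>
      (\<lambda>x. Re (u (slice i j l M x))) \<in> helmholtz (2 * (real M)\<^sup>2)
      \<and> (\<forall>x y. torus_rel x y \<longrightarrow> u (slice i j l M x) = u (slice i j l M y))"
    by (elim exE conjE)
  then show thesis
    by (intro that[of N] N[rule_format, THEN conjunct1] N[rule_format, THEN conjunct2, rule_format])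
qed

section \<open>Confinement of a nodal domain\<close>

lemma open_torus_proj_image: "open U \<Longrightarrow> open (torus_proj ` U)"
  for U :: "(real ^ 'n::finite) set"
proof (unfold open_contains_ball, intro ballI)
  fix q assume U: "\<forall>x\<in>U. \<exists>e>0. ball x e \<subseteq> U" and "q \<in> torus_proj ` U"
  then obtain x e where x: "q = torus_proj x" "e > 0" "ball x e \<subseteq> U" by blast
  then have "ball q e \<subseteq> torus_proj ` U" by (metis image_mono torus_proj_ball)
  then show "\<exists>e>0. ball q e \<subseteq> torus_proj ` U" using x by blast
qed

lemma continuous_on_torus_proj: "continuous_on S (torus_proj :: real ^ 'n::finite \<Rightarrow> _)"
  unfolding continuous_on_iff by (meson dist_torus_le order_le_less_trans dist_commute)

lemma dist_two_coordinates:
  fixes x :: "real ^ 'n::finite"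
  assumes "i \<noteq> j"
  shows "dist x (x + axis i a + axis j b) = norm (Complex a b)"
proof -
  have "dist x (x + axis i a + axis j b) = norm (axis i a + axis j b)"
    unfolding add.assoc dist_commute[of x] by (simp add: dist_norm)
  also have "\<dots> = sqrt (a\<^sup>2 + b\<^sup>2)"
    using assms
    by (simp add: norm_eq_sqrt_inner inner_add_left inner_add_right inner_axis_axis power2_eq_square)
  finally show ?thesis by (simp add: cmod_def)
qed

text \<open>The image \<open>P\<close> of the rescaled region is closed, and its positive part is
  open because \<open>inner\<close> moves positive points into the interior; so a component starting
  there stays in \<open>P\<close>. A ball centred in \<open>P\<close> with radius above
  \<open>\<epsilon> / M\<close> would contain a point outside \<open>P\<close> by
  \<open>hole\<close>.\<close>

lemma thin_nodal_domain:
  fixes i j l :: "'n::finite" and f :: "real ^ 'n \<Rightarrow> real"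
  defines "\<phi> \<equiv> \<lambda>p. f (torus_rep p)"
  assumes ijl: "i \<noteq> j" "i \<noteq> l" "j \<noteq> l" and M: "M \<ge> 2"
    and cont: "continuous_on UNIV f" and per: "\<And>x y. torus_rel x y \<Longrightarrow> f x = f y"
    and f: "\<And>x. f x = Re (u (slice i j l M x))"
    and D: "closed D" "p \<in> D" "Re (u p) > 0"
    and box: "\<And>q. q \<in> D \<Longrightarrow> \<bar>Re (fst q)\<bar> \<le> pi \<and> \<bar>Im (fst q)\<bar> \<le> pi \<and> \<bar>snd q\<bar> \<le> pi"
    and inner: "\<And>q. q \<in> D \<Longrightarrow> Re (u q) > 0 \<Longrightarrow> q \<in> interior D"
    and hole: "\<And>q. q \<in> D \<Longrightarrow> \<exists>w. \<bar>Re w\<bar> \<le> pi \<and> \<bar>Im w\<bar> \<le> pi \<and> dist (fst q) w < \<epsilon> \<and> (w, snd q) \<notin> D"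
  obtains \<Omega> where "\<Omega> \<in> nodal_domains \<phi>" "0 \<le> inrad \<Omega>" "inrad \<Omega> \<le> \<epsilon> / M"
proof -
  let ?g = "slice i j l M"
  have M0: "real M > 0" using M by simp
  have \<phi>: "\<phi> (torus_proj x) = f x" for x
    unfolding \<phi>_def by (rule per[OF torus_rel_rep])
  have cont_g: "continuous_on UNIV ?g"
    unfolding slice_def Complex_eq by (intro continuous_intros)
  define C where "C = ?g -` D"
  define P where "P = torus_proj ` C"
  have Cbox: "\<bar>x $ i\<bar> \<le> pi / M" "\<bar>x $ j\<bar> \<le> pi / M" "\<bar>x $ l\<bar> \<le> pi / M" if "x \<in> C" for x
    using box[of "?g x"] that M0
    by (auto simp: C_def slice_def abs_mult le_divide_eq mult.commute)
  \<comment> \<open>The rescaled cube has at most half the width of a fundamental cell, so its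
    points are determined modulo \<open>2 * pi\<close> in the three coordinates; this is used in
    \<open>eq\<close> below.\<close>
  have piM: "pi / M \<le> pi / 2" using M by (intro divide_left_mono) auto
  have "closed C" unfolding C_def by (intro closed_vimage[OF D(1)] cont_g)
  have "P = torus_proj ` (C \<inter> {x. \<forall>k. x $ k \<in> {- pi..pi}})"
  proof
    show "P \<subseteq> torus_proj ` (C \<inter> {x. \<forall>k. x $ k \<in> {- pi..pi}})"
    proof
      fix q assume "q \<in> P"
      then obtain x where x: "x \<in> C" "q = torus_proj x" by (auto simp: P_def)
      \<comment> \<open>Only coordinates ignored by \<open>slice\<close> are reduced modulo
        \<open>2 * pi\<close>, so \<open>y\<close> stays in \<open>C\<close>, and \<open>P\<close>
        is the image of a compact set.\<close>
      define y where "y = (\<chi> k. if k \<in> {i, j, l} then x $ k else x $ k - 2 * pi * round (x $ k / (2 * pi)))"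
      have "torus_rel x y"
        unfolding torus_rel_def
      proof
        fix k
        show "\<exists>m::int. x $ k - y $ k = 2 * pi * of_int m"
          by (cases "k \<in> {i, j, l}") (auto simp: y_def intro: exI[of _ 0])
      qed
      then have "q = torus_proj y" using x torus_proj_eq_iff by blast
      moreover have "?g y = ?g x" by (simp add: slice_def y_def)
      then have "y \<in> C" using x by (simp add: C_def)
      moreover have "y $ k \<in> {- pi..pi}" for k
      proof (cases "k \<in> {i, j, l}")
        case True
        then have "\<bar>x $ k\<bar> \<le> pi / M" using Cbox[OF x(1)] by auto
        also note piM
        also have "pi / 2 \<le> pi" by simp
        finally show ?thesis using True by (auto simp: y_def)
      next
        case False
        have "\<bar>of_int (round (x $ k / (2 * pi))) - x $ k / (2 * pi)\<bar> \<le> 1 / 2"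
          by (rule of_int_round_abs_le)
        then have "2 * pi * \<bar>of_int (round (x $ k / (2 * pi))) - x $ k / (2 * pi)\<bar> \<le> 2 * pi * (1 / 2)"
          by (intro mult_left_mono) auto
        moreover have "y $ k = - (2 * pi * (of_int (round (x $ k / (2 * pi))) - x $ k / (2 * pi)))"
          using False by (simp add: y_def algebra_simps)
        ultimately have "\<bar>y $ k\<bar> \<le> pi" by (simp add: abs_mult)
        then show ?thesis by auto
      qed
      ultimately show "q \<in> torus_proj ` (C \<inter> {x. \<forall>k. x $ k \<in> {- pi..pi}})" by blast
    qed
  qed (auto simp: P_def)
  moreover have "compact (C \<inter> {x. \<forall>k. x $ k \<in> {- pi..pi}})"
  proof -
    have "{x :: real ^ 'n. \<forall>k. x $ k \<in> {- pi..pi}} = cbox (\<chi> k. - pi) (\<chi> k. pi)"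
      by (auto simp: mem_box_cart)
    then show ?thesis using \<open>closed C\<close> by (metis closed_Int_compact compact_cbox)
  qed
  ultimately have "compact P" by (simp only: compact_continuous_image[OF continuous_on_torus_proj])
  then have "closed P" by (rule compact_imp_closed)
  define pos where "pos = {q. \<phi> q > 0}"
  define neg where "neg = {q. \<phi> q < 0}"
  have img: "{q. Q (\<phi> q)} = torus_proj ` {x. Q (f x)}" for Q
  proof
    show "{q. Q (\<phi> q)} \<subseteq> torus_proj ` {x. Q (f x)}"
    proof
      fix q assume "q \<in> {q. Q (\<phi> q)}"
      moreover obtain x where "torus_proj x = q" using torus_proj_surj by blast
      ultimately show "q \<in> torus_proj ` {x. Q (f x)}" using \<phi>[of x] by auto
    qed
  qed (auto simp: \<phi>)
  have pos_eq: "pos = torus_proj ` {x. f x > 0}" and neg_eq: "neg = torus_proj ` {x. f x < 0}"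
    unfolding pos_def neg_def by (rule img)+
  have "open {x. f x > 0}" "open {x. f x < 0}" by (intro open_Collect_less cont continuous_on_const)+
  then have "open pos" "open neg" by (simp_all only: pos_eq neg_eq open_torus_proj_image)
  have A_eq: "P \<inter> pos = torus_proj ` ((?g -` interior D) \<inter> {x. f x > 0})"
  proof
    show "P \<inter> pos \<subseteq> torus_proj ` ((?g -` interior D) \<inter> {x. f x > 0})"
    proof
      fix q assume q: "q \<in> P \<inter> pos"
      then obtain x where x: "x \<in> C" "q = torus_proj x" by (auto simp: P_def)
      then have "f x > 0" using q \<phi> by (simp add: pos_def)
      then have "?g x \<in> interior D" using x inner[of "?g x"] by (simp add: C_def f)
      then show "q \<in> torus_proj ` ((?g -` interior D) \<inter> {x. f x > 0})" using x \<open>f x > 0\<close> by blast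
    qed
    show "torus_proj ` ((?g -` interior D) \<inter> {x. f x > 0}) \<subseteq> P \<inter> pos"
      using interior_subset[of D] \<phi> by (auto simp: P_def C_def pos_def)
  qed
  have "open (P \<inter> pos)" unfolding A_eq
    by (intro open_torus_proj_image open_Int open_vimage open_interior cont_g open_Collect_less cont continuous_on_const)
  define x0 where "x0 = axis i (Re (fst p) / M) + axis j (Im (fst p) / M) + axis l (snd p / M)"
  have gx0: "?g x0 = p"
    using ijl M0 by (cases p) (auto simp: slice_def x0_def axis_def complex_eq_iff)
  have fx0: "f x0 > 0" using D(3) by (simp add: f gx0)
  define \<Omega> where "\<Omega> = connected_component_set {q. \<phi> q \<noteq> 0} (torus_proj x0)"
  have "torus_proj x0 \<in> {q. \<phi> q \<noteq> 0}" using fx0 by (simp add: \<phi>)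
  then have nd: "\<Omega> \<in> nodal_domains \<phi>" and x0\<Omega>: "torus_proj x0 \<in> \<Omega>"
    unfolding nodal_domains_def \<Omega>_def by (simp_all add: componentsI)
  have "connected \<Omega>" unfolding \<Omega>_def by simp
  have "\<Omega> \<subseteq> {q. \<phi> q \<noteq> 0}" unfolding \<Omega>_def by (rule connected_component_subset)
  then have "\<Omega> \<subseteq> (P \<inter> pos) \<union> (neg \<union> (pos - P))" by (auto simp: pos_def neg_def)
  moreover have "open (neg \<union> (pos - P))"
    using \<open>open pos\<close> \<open>open neg\<close> \<open>closed P\<close> by (intro open_Un open_Diff)
  moreover have "(P \<inter> pos) \<inter> (neg \<union> (pos - P)) \<inter> \<Omega> = {}" by (auto simp: pos_def neg_def)
  moreover have "torus_proj x0 \<in> P \<inter> pos" using fx0 gx0 D(2) by (auto simp: P_def C_def pos_def \<phi>)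
  ultimately have "(neg \<union> (pos - P)) \<inter> \<Omega> = {}"
    using connectedD[OF \<open>connected \<Omega>\<close> \<open>open (P \<inter> pos)\<close>, of "neg \<union> (pos - P)"] x0\<Omega> by blast
  then have \<Omega>P: "\<Omega> \<subseteq> P"
    using \<open>\<Omega> \<subseteq> (P \<inter> pos) \<union> (neg \<union> (pos - P))\<close> by blast
  have bound: "r \<le> \<epsilon> / M" if r: "0 < r" "ball q r \<subseteq> \<Omega>" for r q
  proof (rule ccontr)
    assume "\<not> r \<le> \<epsilon> / M"
    then have \<epsilon>r: "\<epsilon> / M < r" by simp
    have "q \<in> P" using r \<Omega>P centre_in_ball[of q r] by blast
    then obtain x where x: "x \<in> C" "q = torus_proj x" by (auto simp: P_def)
    then have "?g x \<in> D" by (simp add: C_def)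
    then obtain w where w: "\<bar>Re w\<bar> \<le> pi" "\<bar>Im w\<bar> \<le> pi" "dist (fst (?g x)) w < \<epsilon>" "(w, snd (?g x)) \<notin> D"
      using hole by blast
    define y where "y = x + axis i (Re w / M - x $ i) + axis j (Im w / M - x $ j)"
    have yc: "y $ i = Re w / M" "y $ j = Im w / M" "y $ l = x $ l"
      using ijl by (auto simp: y_def axis_def)
    have gy: "?g y = (w, snd (?g x))" using M0 by (simp add: slice_def yc complex_eq_iff)
    have "dist x y = norm (Complex (Re w / M - x $ i) (Im w / M - x $ j))"
      unfolding y_def by (rule dist_two_coordinates[OF ijl(1)])
    also have "\<dots> = norm ((w - fst (?g x)) / of_real (real M))"
      using M0 by (intro arg_cong[of _ _ norm]) (simp add: complex_eq_iff slice_def field_simps)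
    also have "\<dots> = dist (fst (?g x)) w / M" using M0 by (simp add: norm_divide dist_norm norm_minus_commute)
    also have "\<dots> < r" using w(3) \<epsilon>r M0 by (smt (verit) divide_strict_right_mono)
    finally have "torus_proj y \<in> ball q r" using x dist_torus_le[of x y] by simp
    then have "torus_proj y \<in> P" using r \<Omega>P by blast
    then obtain y' where y': "y' \<in> C" "torus_proj y' = torus_proj y" by (auto simp: P_def)
    have yb: "\<bar>y $ i\<bar> \<le> pi / M" "\<bar>y $ j\<bar> \<le> pi / M" "\<bar>y $ l\<bar> \<le> pi / M"
      using w(1,2) Cbox(3)[OF x(1)] M0 by (simp_all add: yc divide_right_mono)
    have eq: "y' $ k = y $ k" if "\<bar>y' $ k\<bar> \<le> pi / M" "\<bar>y $ k\<bar> \<le> pi / M" for k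
    proof -
      obtain m :: int where m: "y' $ k - y $ k = 2 * pi * of_int m"
        using y'(2) unfolding torus_proj_eq_iff torus_rel_def by blast
      have "\<bar>y' $ k - y $ k\<bar> \<le> pi" using that piM by linarith
      then have "2 * pi * \<bar>of_int m\<bar> \<le> pi" unfolding m by (simp add: abs_mult)
      then have "pi * (2 * \<bar>of_int m\<bar>) \<le> pi * 1" by simp
      then have "2 * \<bar>of_int m :: real\<bar> \<le> 1" by (rule mult_left_le_imp_le) simp
      then have "m = 0" by linarith
      then show ?thesis using m by simp
    qed
    have "?g y' = ?g y" unfolding slice_def using eq Cbox[OF y'(1)] yb by simp
    then show False using y'(1) gy w(4) by (simp add: C_def)
  qed
  \<comment> \<open>Some ball must lie in \<open>\<Omega>\<close>, since the supremum in
    \<open>inrad\<close> is controlled only for a non-empty set of radii.\<close>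
  obtain r0 where r0: "r0 > 0" "ball x0 r0 \<subseteq> {x. f x > 0}"
    using \<open>open {x. f x > 0}\<close> fx0 by (auto simp: open_contains_ball)
  have "ball (torus_proj x0) r0 \<subseteq> \<Omega>"
    unfolding \<Omega>_def
  proof (rule connected_component_maximal)
    show "connected (ball (torus_proj x0) r0)"
      unfolding torus_proj_ball[symmetric]
      by (intro connected_continuous_image continuous_on_torus_proj convex_connected convex_ball)
    show "ball (torus_proj x0) r0 \<subseteq> {q. \<phi> q \<noteq> 0}"
      unfolding torus_proj_ball[symmetric] using r0(2) \<phi> by force
  qed (use r0 in simp)
  then have mem: "r0 \<in> {r. 0 < r \<and> (\<exists>q. ball q r \<subseteq> \<Omega>)}" using r0 by blast
  have le: "r \<le> \<epsilon> / M" if "r \<in> {r. 0 < r \<and> (\<exists>q. ball q r \<subseteq> \<Omega>)}" for r using that bound by blast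
  have "r0 \<le> inrad \<Omega>" unfolding inrad_def by (rule cSup_upper[OF mem bdd_aboveI[OF le]])
  moreover have "inrad \<Omega> \<le> \<epsilon> / M" unfolding inrad_def using mem le by (intro cSup_least) auto
  ultimately show thesis using that nd r0 by simp
qed

section \<open>Scale, eigenvalue and the sequence\<close>

lemma thin_eigenfunction_exists:
  assumes "CARD('n::finite) \<ge> 3"
  obtains ev :: real and \<phi> :: "'n::finite torus \<Rightarrow> real" and \<Omega> where
    "real k < ev" "torus_eigenfunction ev \<phi>" "\<Omega> \<in> nodal_domains \<phi>" "0 \<le> inrad \<Omega>"
    "inrad \<Omega> \<le> sqrt 2 / (real k + 1) * ev powr (- 1 / 2)"
proof -
  obtain S :: "'n set" where "card S = 3"
    using obtain_subset_with_card_n[OF assms] by metis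
  then obtain i j l :: 'n where ijl: "i \<noteq> j" "i \<noteq> l" "j \<noteq> l" by (auto simp: card_3_iff)
  define \<epsilon> where "\<epsilon> = 1 / (real k + 1)"
  have "\<epsilon> > 0" by (simp add: \<epsilon>_def)
  obtain u D p where u: "u \<in> waves" "closed D" "p \<in> D" "Re (u p) > 0"
    and box: "\<And>q. q \<in> D \<Longrightarrow> \<bar>Re (fst q)\<bar> \<le> pi \<and> \<bar>Im (fst q)\<bar> \<le> pi \<and> \<bar>snd q\<bar> \<le> pi"
    and inner: "\<And>q. q \<in> D \<Longrightarrow> Re (u q) > 0 \<Longrightarrow> q \<in> interior D"
    and hole: "\<And>q. q \<in> D \<Longrightarrow> \<exists>w. \<bar>Re w\<bar> \<le> pi \<and> \<bar>Im w\<bar> \<le> pi \<and> dist (fst q) w < \<epsilon> \<and> (w, snd q) \<notin> D"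
    by (rule thin_region_exists[OF \<open>\<epsilon> > 0\<close>], rule that)
  obtain N :: nat where N: "N > 0"
    and helm: "\<And>M. N dvd M \<Longrightarrow> (\<lambda>x. Re (u (slice i j l M x))) \<in> helmholtz (2 * (real M)\<^sup>2)"
    and per: "\<And>M x y. N dvd M \<Longrightarrow> torus_rel x y \<Longrightarrow> u (slice i j l M x) = u (slice i j l M y)"
    by (rule waves_slice[OF u(1) ijl], rule that)
  \<comment> \<open>Divisibility by \<open>N\<close> gives periodicity; the factor
    \<open>k + 2\<close> gives \<open>M \<ge> 2\<close> and an eigenvalue above
    \<open>k\<close>.\<close>
  define M where "M = N * (k + 2)"
  have NM: "N dvd M" by (simp add: M_def)
  have "1 * (k + 2) \<le> N * (k + 2)" using N by (intro mult_right_mono) auto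
  then have M: "k + 2 \<le> M" by (simp add: M_def)
  define f where "f x = Re (u (slice i j l M x))" for x :: "real ^ 'n"
  define ev where "ev = 2 * (real M)\<^sup>2"
  have fh: "f \<in> helmholtz ev" using helm[OF NM] by (simp add: f_def[abs_def] ev_def)
  have fper: "f x = f y" if "torus_rel x y" for x y using per[OF NM that] by (simp add: f_def)
  have M2: "M \<ge> 2" using M by simp
  obtain \<Omega> where \<Omega>: "\<Omega> \<in> nodal_domains (\<lambda>q. f (torus_rep q))" "0 \<le> inrad \<Omega>" "inrad \<Omega> \<le> \<epsilon> / M"
  proof (rule thin_nodal_domain[where f = f and u = u and D = D and p = p and \<epsilon> = \<epsilon>, OF ijl M2])
    show "continuous_on UNIV f" by (rule helmholtz_continuous[OF fh])
  qed (use fper u box inner hole in \<open>simp_all add: f_def\<close>)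
  have "\<exists>x. f x \<noteq> 0"
  proof -
    obtain q where "q \<in> {q. f (torus_rep q) \<noteq> 0}"
      using \<Omega>(1) in_components_nonempty in_components_subset unfolding nodal_domains_def by blast
    then show ?thesis by blast
  qed
  then obtain x where x: "f x \<noteq> 0" by blast
  have eig: "torus_eigenfunction ev (\<lambda>q. f (torus_rep q))"
    by (rule torus_eigenfunctionI[OF fh fper x])
  have M0: "real M \<ge> 1" using M by simp
  have "real k < real M" using M by simp
  also have "\<dots> \<le> 2 * (real M * real M)"
    using M0 mult_right_mono[of 1 "real M" "real M"] by linarith
  finally have kev: "real k < ev" by (simp add: ev_def power2_eq_square)
  have "ev powr (- 1 / 2) = inverse (ev powr (1 / 2))" using powr_minus[of ev "1 / 2"] by simp
  also have "\<dots> = 1 / (sqrt 2 * real M)"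
    by (simp add: ev_def powr_half_sqrt real_sqrt_mult inverse_eq_divide)
  finally have "\<epsilon> / M = sqrt 2 / (real k + 1) * ev powr (- 1 / 2)" by (simp add: \<epsilon>_def)
  then show thesis using that[OF kev eig \<Omega>(1,2)] \<Omega>(3) by simp
qed

theorem theorem1p2:
  assumes "CARD('n::finite) \<ge> 3"
  shows "\<exists>(ev :: nat \<Rightarrow> real) (\<phi> :: nat \<Rightarrow> 'n torus \<Rightarrow> real) (\<Omega> :: nat \<Rightarrow> 'n torus set).
           (\<forall>k. 0 < ev k) \<and> filterlim ev at_top sequentially \<and>
           (\<forall>k. torus_eigenfunction (ev k) (\<phi> k)) \<and>
           (\<forall>k. \<Omega> k \<in> nodal_domains (\<phi> k)) \<and>
           (\<lambda>k. inrad (\<Omega> k)) \<in> o(\<lambda>k. ev k powr (- 1 / 2))"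
proof -
  define P where "P k = (\<lambda>(ev, \<phi> :: 'n torus \<Rightarrow> real, \<Omega>). real k < ev \<and> torus_eigenfunction ev \<phi>
    \<and> \<Omega> \<in> nodal_domains \<phi> \<and> 0 \<le> inrad \<Omega> \<and> inrad \<Omega> \<le> sqrt 2 / (real k + 1) * ev powr (- 1 / 2))" for k
  have "\<forall>k. \<exists>t. P k t"
  proof
    fix k
    obtain ev :: real and \<phi> :: "'n torus \<Rightarrow> real" and \<Omega> where
      "real k < ev" "torus_eigenfunction ev \<phi>" "\<Omega> \<in> nodal_domains \<phi>" "0 \<le> inrad \<Omega>"
      "inrad \<Omega> \<le> sqrt 2 / (real k + 1) * ev powr (- 1 / 2)"
      by (rule thin_eigenfunction_exists[OF assms, of k], rule that)
    then have "P k (ev, \<phi>, \<Omega>)" by (simp add: P_def)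
    then show "\<exists>t. P k t" ..
  qed
  then obtain F where F: "\<And>k. P k (F k)" by (blast dest: choice)
  define ev where "ev k = fst (F k)" for k
  define \<phi> where "\<phi> k = fst (snd (F k))" for k
  define \<Omega> where "\<Omega> k = snd (snd (F k))" for k
  have *: "real k < ev k" "torus_eigenfunction (ev k) (\<phi> k)" "\<Omega> k \<in> nodal_domains (\<phi> k)"
    "0 \<le> inrad (\<Omega> k)" "inrad (\<Omega> k) \<le> sqrt 2 / (real k + 1) * ev k powr (- 1 / 2)" for k
    using F[of k] by (simp_all add: P_def ev_def \<phi>_def \<Omega>_def case_prod_beta)
  have ev_pos: "0 < ev k" for k using *(1)[of k] by linarith
  have "filterlim ev at_top sequentially"
    by (rule filterlim_at_top_mono[OF filterlim_real_sequentially]) (intro always_eventually allI less_imp_le *(1))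
  moreover have "(\<lambda>k. inrad (\<Omega> k)) \<in> o(\<lambda>k. ev k powr (- 1 / 2))"
  proof (rule smalloI_tendsto)
    show "(\<lambda>k. inrad (\<Omega> k) / ev k powr (- 1 / 2)) \<longlonglongrightarrow> 0"
    proof (rule tendsto_sandwich[where f = "\<lambda>_. 0" and h = "\<lambda>k. sqrt 2 / (real k + 1)"])
      have "(\<lambda>k. sqrt 2 * (1 / real (Suc k))) \<longlonglongrightarrow> 0"
        by (intro tendsto_mult_right_zero LIMSEQ_Suc[OF lim_1_over_n])
      then show "(\<lambda>k. sqrt 2 / (real k + 1)) \<longlonglongrightarrow> 0" by (simp add: add.commute)
      show "eventually (\<lambda>k. inrad (\<Omega> k) / ev k powr (- 1 / 2) \<le> sqrt 2 / (real k + 1)) sequentially"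
      proof (intro always_eventually allI)
        fix k
        have "ev k powr (- 1 / 2) > 0" using ev_pos[of k] by simp
        then show "inrad (\<Omega> k) / ev k powr (- 1 / 2) \<le> sqrt 2 / (real k + 1)"
          using *(5)[of k] by (simp only: pos_divide_le_eq)
      qed
    qed (use *(4) in auto)
    show "eventually (\<lambda>k. ev k powr (- 1 / 2) \<noteq> 0) sequentially"
      using ev_pos by (intro always_eventually allI) (simp add: less_imp_neq[THEN not_sym])
  qed
  ultimately show ?thesis using ev_pos *(2,3) by blast
qed

end
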